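(* There exist two simple curves $\gamma_1,\gamma_2\colon[0,T]\to\overline{\mathbb D}\setminus\{0\}$ with $\gamma_k(0)\in\partial\mathbb D$, $\Gamma_k:=\gamma_k(0,T]\subset\mathbb D\setminus\{0\}$, $\Gamma_1\cap\Gamma_2=\emptyset$ and $\overline{\Gamma_1}\cap\overline{\Gamma_2}=\{p\}\subset\partial\mathbb D$, such that each $\gamma_k$ is a $\mathbb D$-Loewner parametrization for $\Gamma_k$ at every $t_0\in[0,T]$, but the family $(g_t)$ is not differentiable at $t=0$, i.e. it is not the case that $t\mapsto g_t(z)$ is differentiable at $t=0$ for every $z\in\Omega_T$.
   Context: $\mathbb D$ is the open unit disk. $\Omega_t:=\mathbb D\setminus(\gamma_1[0,t]\cup\gamma_2[0,t])$ and $g_t$ is the unique conformal map of $\Omega_t$ onto $\mathbb D$ with $g_t(0)=0$, $g_t'(0)>0$. For $k=1,2$, $h_{k;t}$ is the unique conformal map of $\mathbb D\setminus\gamma_k[0,t]$ onto $\mathbb D$ with $h_{k;t}(0)=0$, $h_{k;t}'(0)>0$; $\gamma_k$ is a $\mathbb D$-Loewner parametrization for $\Gamma_k$ at $t_0$ if $t\mapsto\log h_{k;t}'(0)$ is differentiable at $t_0$ (equivalently, $t\mapsto h_{k;t}(z)$ is differentiable at $t_0$ for every $z\in\mathbb D\setminus\Gamma_k$). *)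

theory Defs
  imports "HOL-Complex_Analysis.Complex_Analysis"
begin

text \<open>The unique conformal map of a domain U (containing 0) onto the unit disk,
  normalized by f 0 = 0 and f'(0) > 0. Outside U the function is fixed to 0
  so that the description determines a unique function.\<close>
definition norm_conf_map :: "complex set \<Rightarrow> complex \<Rightarrow> complex" where
  "norm_conf_map U = (THE f. f holomorphic_on U \<and> inj_on f U \<and> f ` U = ball 0 1 \<and>
      f 0 = 0 \<and> deriv f 0 \<in> \<real> \<and> Re (deriv f 0) > 0 \<and> (\<forall>z. z \<notin> U \<longrightarrow> f z = 0))"

definition hmap :: "(real \<Rightarrow> complex) \<Rightarrow> real \<Rightarrow> complex \<Rightarrow> complex" where
  "hmap \<gamma> t = norm_conf_map (ball 0 1 - \<gamma> ` {0..t})"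

definition gmap :: "(real \<Rightarrow> complex) \<Rightarrow> (real \<Rightarrow> complex) \<Rightarrow> real \<Rightarrow> complex \<Rightarrow> complex" where
  "gmap \<gamma>1 \<gamma>2 t = norm_conf_map (ball 0 1 - (\<gamma>1 ` {0..t} \<union> \<gamma>2 ` {0..t}))"

definition loewner_param_at :: "(real \<Rightarrow> complex) \<Rightarrow> real \<Rightarrow> real \<Rightarrow> bool" where
  "loewner_param_at \<gamma> T t0 \<longleftrightarrow>
     (\<lambda>t. ln (Re (deriv (hmap \<gamma> t) 0))) differentiable (at t0 within {0..T})"

end

theory Submission
  imports Defs
begin

text \<open>Take the curves \<open>\<gamma>\<^sub>1 = (1 - s) e\<^sup>i\<^sup>\<phi>\<^sup>(\<^sup>s\<^sup>)\<close> and \<open>\<gamma>\<^sub>2 = cnj \<gamma>\<^sub>1\<close> for a profile \<open>\<phi> > 0\<close> with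
  \<open>\<phi> 0 = 0\<close>. By symmetry both have the same capacity (logarithm of the derivative at \<open>0\<close> of the
  normalised conformal map) \<open>t\<close>, and both are reparametrised by it, which makes each of them a Loewner
  parametrization. Let \<open>J\<close> be the joint capacity. If the \<open>g\<^sub>t\<close> were differentiable at \<open>t = 0\<close>,
  then \<open>J / t\<close> would converge as \<open>t\<close> tends to \<open>0\<close> (Montel). If the two curves nearly coincide up to
  some scale, \<open>J / t\<close> is close to \<open>1\<close> there; if they look like two well separated radial slits, it
  is at least about \<open>4 / 3\<close>. Capacities depend continuously on the profile (kernel convergence), so
  each of these behaviours at arbitrarily small scales is an open dense condition, and by Baire's
  theorem some profile shows both.\<close>

section \<open>Normalised conformal maps and the Schwarz lemma\<close>

text \<open>Both curves run exactly at unit capacity speed, so everything rests on the ratio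
  \<open>cap2 / cap1\<close> at small scales. Pointwise differentiability of the maps says nothing
  directly about their derivatives at 0; a Harnack-type bound of the displacement of points near 0
  by three times the joint capacity supplies the normal family that carries the limit over to the
  derivative. For slits very far apart compared with their length the ratio would approach 2, but
  any constant above 1 serves: 4/3 is what the maximum principle yields for slits of length
  \<open>s\<close> whose base points are only \<open>4 * s\<close> apart, and 5/4 leaves room for an
  approximation. A direct construction would have to interleave scales and control how each
  modification disturbs what was already achieved, with quantitative continuity of capacity. Kernel
  convergence gives continuity without rates, which is all that openness in Baire's theorem asks.
  The profiles built to have ratio near 1 are flat near 0, where the two curves coincide;
  disjointness is therefore a further generic condition, positivity away from 0.\<close>

definition nconf :: "complex set \<Rightarrow> (complex \<Rightarrow> complex) \<Rightarrow> bool" where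
  "nconf W f \<longleftrightarrow> f holomorphic_on W \<and> inj_on f W \<and> f ` W = ball 0 1 \<and>
      f 0 = 0 \<and> deriv f 0 \<in> \<real> \<and> Re (deriv f 0) > 0"

text \<open>Simple connectedness and openness feed the Riemann mapping theorem; containment in the
  unit disk makes the identity a competitor in the Schwarz lemma, which gives nonnegative
  capacity.\<close>

definition adm :: "complex set \<Rightarrow> bool" where
  "adm W \<longleftrightarrow> open W \<and> simply_connected W \<and> 0 \<in> W \<and> W \<subseteq> ball 0 1"

lemma nconf_norm_less:
  assumes "nconf W h" "z \<in> W"
  shows "norm (h z) < 1"
  using assms unfolding nconf_def by (metis dist_0_norm image_eqI mem_ball)

lemma nconf_deriv_norm:
  assumes "nconf W h"
  shows "norm (deriv h 0) = Re (deriv h 0)" "deriv h 0 = of_real (Re (deriv h 0))"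
proof -
  show eq: "deriv h 0 = of_real (Re (deriv h 0))"
    using assms by (simp add: nconf_def complex_is_Real_iff complex_eq_iff)
  show "norm (deriv h 0) = Re (deriv h 0)"
    using assms cmod_eq_Re[of "deriv h 0"] unfolding nconf_def complex_is_Real_iff by linarith
qed

lemma nconf_inverse:
  assumes "nconf W h" "open W" "0 \<in> W"
  obtains g where "g holomorphic_on ball 0 1" "g ` ball 0 1 = W" "\<And>z. z \<in> W \<Longrightarrow> g (h z) = z"
    "\<And>z. z \<in> ball 0 1 \<Longrightarrow> h (g z) = z" "inj_on g (ball 0 1)" "g 0 = 0" "deriv g 0 = 1 / deriv h 0"
proof -
  have h: "h holomorphic_on W" "inj_on h W" "h ` W = ball 0 1" "h 0 = 0"
    using assms by (auto simp: nconf_def)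
  obtain g where g: "g holomorphic_on (h ` W)" "\<And>z. z \<in> W \<Longrightarrow> deriv h z * deriv g (h z) = 1"
      "\<And>z. z \<in> W \<Longrightarrow> g (h z) = z"
    using holomorphic_has_inverse[OF h(1) assms(2) h(2)] by blast
  have gim: "g ` ball 0 1 = W" using g(3) h(3)
    by (metis (no_types, lifting) image_cong image_ident image_image)
  have hg: "h (g z) = z" if "z \<in> ball 0 1" for z
    using that g(3) h(3) by (metis imageE)
  have "inj_on g (ball 0 1)" using hg by (metis inj_on_inverseI)
  moreover have "g 0 = 0" using g(3)[OF assms(3)] h(4) by simp
  moreover have "deriv g 0 = 1 / deriv h 0"
    using g(2)[OF assms(3)] h(4) by (metis divide_eq_eq mult.commute mult_zero_right zero_neq_one)
  ultimately show thesis using that g h(3) gim hg by metis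
qed

text \<open>The classical Schwarz lemma applied to \<open>f\<close> composed with the inverse of
  \<open>h\<close>. Uniqueness of the normalised map and monotonicity of the capacity both come from
  it.\<close>

lemma schwarz_nconf:
  assumes h: "nconf W h" and W: "open W" "0 \<in> W"
    and f: "f holomorphic_on W" "f ` W \<subseteq> ball 0 1" "f 0 = 0"
  shows "z \<in> W \<Longrightarrow> norm (f z) \<le> norm (h z)"
    and "norm (deriv f 0) \<le> Re (deriv h 0)"
    and "norm (deriv f 0) = Re (deriv h 0) \<Longrightarrow> \<exists>\<alpha>. norm \<alpha> = 1 \<and> (\<forall>z\<in>W. f z = \<alpha> * h z)"
proof -
  obtain g where g: "g holomorphic_on ball 0 1" "g ` ball 0 1 = W" "\<And>z. z \<in> W \<Longrightarrow> g (h z) = z"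
    "\<And>z. z \<in> ball 0 1 \<Longrightarrow> h (g z) = z" "g 0 = 0" "deriv g 0 = 1 / deriv h 0"
    using nconf_inverse[OF h W] by metis
  define F where "F = f \<circ> g"
  have F: "F z = f (g z)" for z by (simp add: F_def)
  have hol: "F holomorphic_on ball 0 1"
    unfolding F_def using f(1) g(1,2) holomorphic_on_compose_gen by blast
  have 0: "F 0 = 0" using f g by (simp add: F)
  have lt: "norm (F z) < 1" if "norm z < 1" for z
  proof -
    have "g z \<in> W" using g(2) that by auto
    then show ?thesis using f(2) by (auto simp: F)
  qed
  have dh: "Re (deriv h 0) > 0" "deriv h 0 \<noteq> 0" using h by (auto simp: nconf_def)
  have der: "deriv F 0 = deriv f 0 / deriv h 0"
  proof -
    have "deriv F 0 = deriv f (g 0) * deriv g 0"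
      unfolding F_def using f(1) g(1,5) W by (intro deriv_chain) (auto simp: holomorphic_on_imp_differentiable_at)
    then show ?thesis using g by simp
  qed
  have nd: "norm (deriv F 0) = norm (deriv f 0) / Re (deriv h 0)"
    unfolding der norm_divide nconf_deriv_norm(1)[OF h] ..
  note S = Schwarz_Lemma[OF hol 0 lt]
  show "norm (f z) \<le> norm (h z)" if "z \<in> W"
    using S(1)[of "h z"] that g(3) nconf_norm_less[OF h] by (simp add: F)
  have "norm (deriv F 0) \<le> 1" using S(2)[of 0] by simp
  then show "norm (deriv f 0) \<le> Re (deriv h 0)" unfolding nd using dh by (simp add: divide_le_eq)
  show "\<exists>\<alpha>. norm \<alpha> = 1 \<and> (\<forall>z\<in>W. f z = \<alpha> * h z)" if "norm (deriv f 0) = Re (deriv h 0)"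
  proof -
    have "norm (deriv F 0) = 1" unfolding nd using that dh by simp
    then obtain \<alpha> where \<alpha>: "\<And>z. norm z < 1 \<Longrightarrow> F z = \<alpha> * z" "norm \<alpha> = 1"
      using S(3)[of 0] by auto
    have "f z = \<alpha> * h z" if "z \<in> W" for z
      using \<alpha>(1)[of "h z"] that g(3) nconf_norm_less[OF h] by (simp add: F)
    with \<alpha> show ?thesis by auto
  qed
qed

text \<open>Each map is a competitor for the other, so the derivatives at 0 agree; the equality case
  gives a rotation, and positivity of both derivatives makes the rotation trivial.\<close>

lemma nconf_unique:
  assumes W: "open W" "0 \<in> W" and f: "nconf W f" and g: "nconf W g" and z: "z \<in> W"
  shows "f z = g z"
proof -
  note f' = f[unfolded nconf_def] and g' = g[unfolded nconf_def]
  have "norm (deriv f 0) \<le> Re (deriv g 0)" "norm (deriv g 0) \<le> Re (deriv f 0)"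
    using schwarz_nconf(2)[OF g W, of f] schwarz_nconf(2)[OF f W, of g] f' g' by auto
  then have eq: "Re (deriv f 0) = Re (deriv g 0)" "norm (deriv f 0) = Re (deriv g 0)"
    using nconf_deriv_norm(1)[OF f] nconf_deriv_norm(1)[OF g] by auto
  obtain \<alpha> where \<alpha>: "norm \<alpha> = 1" "\<forall>z\<in>W. f z = \<alpha> * g z"
    using schwarz_nconf(3)[OF g W, of f] f' eq by auto
  have "deriv f 0 = deriv (\<lambda>z. \<alpha> * g z) 0"
    using \<alpha> W by (intro deriv_cong_ev) (auto simp: eventually_nhds)
  also have "\<dots> = \<alpha> * deriv g 0"
    using g' W by (intro deriv_cmult) (auto simp: holomorphic_on_imp_differentiable_at)
  finally have "deriv f 0 = \<alpha> * deriv g 0" .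
  moreover have "deriv f 0 = deriv g 0"
    using eq nconf_deriv_norm(2)[OF f] nconf_deriv_norm(2)[OF g] by simp
  ultimately have "\<alpha> = 1" using g' by auto
  then show ?thesis using \<alpha> z by simp
qed

lemma adm_imp_connected: "adm W \<Longrightarrow> connected W"
  by (simp add: adm_def simply_connected_imp_connected)

lemma adm_exists_nconf:
  assumes "adm W"
  obtains h where "nconf W h"
proof -
  have W: "open W" "simply_connected W" "0 \<in> W" "W \<subseteq> ball 0 1" using assms by (auto simp: adm_def)
  have "W \<noteq> UNIV" using W(4) by (metis UNIV_I dist_0_norm mem_ball norm_one order_less_irrefl subsetD)
  then obtain f g where fg: "f holomorphic_on W" "g holomorphic_on ball 0 1"
     "\<And>z. z \<in> W \<Longrightarrow> f z \<in> ball 0 1 \<and> g (f z) = z" "\<And>z. z \<in> ball 0 1 \<Longrightarrow> g z \<in> W \<and> f (g z) = z"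
    using Riemann_mapping_theorem[of W] W by blast
  define a where "a = f 0"
  have a: "norm a < 1" using fg(3)[OF W(3)] by (simp add: a_def)
  \<comment> \<open>The Riemann map may send 0 to any point \<open>a\<close>; the Moebius map moves
    it back to 0.\<close>
  define m where "m = Moebius_function 0 a \<circ> f"
  have mim: "m ` W = ball 0 1"
  proof
    show "m ` W \<subseteq> ball 0 1"
      using fg(3) Moebius_function_norm_lt_1[OF a] by (auto simp: m_def)
    show "ball 0 1 \<subseteq> m ` W"
    proof
      fix z :: complex assume z: "z \<in> ball 0 1"
      define w where "w = Moebius_function 0 (-a) z"
      have w: "w \<in> ball 0 1" using z a Moebius_function_norm_lt_1[of "-a" z 0] by (simp add: w_def)
      have "Moebius_function 0 a w = z"
        unfolding w_def using a z by (intro Moebius_function_compose) auto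
      then have "m (g w) = z" using fg(4)[OF w] by (simp add: m_def)
      then show "z \<in> m ` W" using fg(4)[OF w] by auto
    qed
  qed
  have minj: "inj_on m W"
  proof (rule inj_onI)
    fix x y assume xy: "x \<in> W" "y \<in> W" "m x = m y"
    have "f x = Moebius_function 0 (-a) (m x)" if "x \<in> W" for x
      unfolding m_def comp_def using a fg(3)[OF that]
      by (intro Moebius_function_compose[symmetric]) auto
    then have "f x = f y" using xy by metis
    then show "x = y" using fg(3) xy by metis
  qed
  have mhol: "m holomorphic_on W"
    unfolding m_def
    by (rule holomorphic_on_compose_gen[OF fg(1) Moebius_function_holomorphic[OF a]]) (use fg(3) in auto)
  have m0: "m 0 = 0" by (simp add: m_def a_def Moebius_function_def)
  define d where "d = deriv m 0"
  have d: "d \<noteq> 0" unfolding d_def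
    using holomorphic_injective_imp_regular[OF mhol W(1) minj] W(3) by blast
  \<comment> \<open>The rotation that turns the derivative \<open>d\<close> into its
    modulus.\<close>
  define c where "c = cnj d / norm d"
  have c: "norm c = 1" using d by (simp add: c_def norm_divide)
  have c0: "c \<noteq> 0" using c by auto
  define h where "h = (\<lambda>z. c * m z)"
  have "h ` W = (*) c ` ball 0 1" using mim by (auto simp: h_def image_image[symmetric])
  also have "\<dots> = ball 0 1"
  proof
    show "(*) c ` ball 0 1 \<subseteq> ball 0 1" using c by (auto simp: norm_mult)
    show "ball 0 1 \<subseteq> (*) c ` ball 0 1"
    proof
      fix z :: complex assume "z \<in> ball 0 1"
      then have "z / c \<in> ball 0 1" "z = c * (z / c)" using c c0 by (auto simp: norm_divide)
      then show "z \<in> (*) c ` ball 0 1" by blast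
    qed
  qed
  finally have him: "h ` W = ball 0 1" .
  have "deriv h 0 = c * d" unfolding h_def d_def
    using mhol W by (intro deriv_cmult) (auto simp: holomorphic_on_imp_differentiable_at)
  also have "\<dots> = of_real ((norm d)\<^sup>2) / of_real (norm d)"
    unfolding c_def complex_norm_square by (simp add: mult.commute)
  also have "\<dots> = of_real (norm d)" by (simp add: power2_eq_square)
  finally have dh: "deriv h 0 = of_real (norm d)" .
  have "nconf W h"
    unfolding nconf_def
    using him dh d m0 c0 minj mhol
    by (auto simp: h_def inj_on_def intro!: holomorphic_intros)
  then show thesis by (rule that)
qed

lemma nconf_norm_conf_map:
  assumes "adm W"
  shows "nconf W (norm_conf_map W)"
proof -
  let ?P = "\<lambda>f. f holomorphic_on W \<and> inj_on f W \<and> f ` W = ball 0 1 \<and>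
      f 0 = 0 \<and> deriv f 0 \<in> \<real> \<and> Re (deriv f 0) > 0 \<and> (\<forall>z. z \<notin> W \<longrightarrow> f z = 0)"
  have W: "open W" "0 \<in> W" using assms by (auto simp: adm_def)
  obtain h where h: "nconf W h" using adm_exists_nconf[OF assms] .
  \<comment> \<open>The description in \<open>norm_conf_map\<close> also prescribes the value 0 off
    \<open>W\<close>, so that \<open>THE\<close> determines a total function; the witness has to be
    extended accordingly.\<close>
  define h' where "h' = (\<lambda>z. if z \<in> W then h z else 0)"
  have ev: "deriv h' 0 = deriv h 0"
    using W by (intro deriv_cong_ev) (auto simp: eventually_nhds h'_def)
  have "h' holomorphic_on W" using h by (auto simp: nconf_def h'_def cong: holomorphic_cong)
  moreover have "inj_on h' W" using h by (auto simp: nconf_def h'_def inj_on_def)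
  moreover have "h' ` W = ball 0 1"
    using h unfolding nconf_def h'_def by (simp cong: image_cong)
  moreover have "h' 0 = 0" "\<forall>z. z \<notin> W \<longrightarrow> h' z = 0" using h by (auto simp: nconf_def h'_def)
  moreover have "deriv h' 0 \<in> \<real>" "0 < Re (deriv h' 0)" using h by (auto simp: nconf_def ev)
  ultimately have P: "?P h'" by blast
  then have n: "nconf W h'" unfolding nconf_def by blast
  have "f = h'" if f: "?P f" for f
  proof
    fix z
    have "nconf W f" using f unfolding nconf_def by blast
    then have "z \<in> W \<Longrightarrow> f z = h' z" using n by (rule nconf_unique[OF W])
    then show "f z = h' z" using f by (cases "z \<in> W") (simp_all add: h'_def)
  qed
  then have "norm_conf_map W = h'"
    unfolding norm_conf_map_def by (intro the_equality[of ?P h', OF P])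
  with n show ?thesis by simp
qed

section \<open>Capacity and its strict monotonicity\<close>

definition lrad :: "complex set \<Rightarrow> real" where
  "lrad W = ln (Re (deriv (norm_conf_map W) 0))"

lemma exp_lrad:
  assumes "adm W"
  shows "exp (lrad W) = Re (deriv (norm_conf_map W) 0)"
    and "deriv (norm_conf_map W) 0 = of_real (exp (lrad W))"
  using nconf_norm_conf_map[OF assms] nconf_deriv_norm(2)[OF nconf_norm_conf_map[OF assms]]
  by (auto simp: lrad_def nconf_def)

lemma norm_conf_map_norm_ge:
  assumes "adm W" "z \<in> W"
  shows "norm z \<le> norm (norm_conf_map W z)"
  using schwarz_nconf(1)[OF nconf_norm_conf_map[OF assms(1)], of "\<lambda>z. z"] assms by (auto simp: adm_def)

lemma lrad_nonneg:
  assumes "adm W"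
  shows "0 \<le> lrad W"
proof -
  have "norm (deriv (\<lambda>z::complex. z) 0) \<le> Re (deriv (norm_conf_map W) 0)"
    using schwarz_nconf(2)[OF nconf_norm_conf_map[OF assms(1)], of "\<lambda>z. z"] assms by (auto simp: adm_def)
  then show ?thesis by (simp add: lrad_def)
qed

text \<open>Equal capacities would make the map of the larger domain a rotation of the other one on
  \<open>W\<close>. The latter is already onto the disk, so the value at a point of
  \<open>W'\<close> outside \<open>W\<close> would be taken a second time inside \<open>W\<close>,
  against injectivity.\<close>

lemma lrad_strict_antimono:
  assumes "adm W" "adm W'" "W \<subset> W'"
  shows "lrad W' < lrad W"
proof -
  let ?h = "norm_conf_map W" and ?h' = "norm_conf_map W'"
  note n = nconf_norm_conf_map[OF assms(1)] and n' = nconf_norm_conf_map[OF assms(2)]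
  have W: "open W" "0 \<in> W" using assms by (auto simp: adm_def)
  have f: "?h' holomorphic_on W" "?h' ` W \<subseteq> ball 0 1" "?h' 0 = 0"
    using n' assms(3) by (auto simp: nconf_def intro: holomorphic_on_subset)
  have le: "Re (deriv ?h' 0) \<le> Re (deriv ?h 0)"
    using schwarz_nconf(2)[OF n W f] nconf_deriv_norm(1)[OF n'] by simp
  have "Re (deriv ?h' 0) \<noteq> Re (deriv ?h 0)"
  proof
    assume eq: "Re (deriv ?h' 0) = Re (deriv ?h 0)"
    obtain \<alpha> where \<alpha>: "norm \<alpha> = 1" "\<forall>z\<in>W. ?h' z = \<alpha> * ?h z"
      using schwarz_nconf(3)[OF n W f] eq nconf_deriv_norm(1)[OF n'] by auto
    obtain w where w: "w \<in> W'" "w \<notin> W" using assms(3) by auto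
    have "norm (?h' w / \<alpha>) < 1" using \<alpha> nconf_norm_less[OF n' w(1)] by (simp add: norm_divide)
    then obtain v where v: "v \<in> W" "?h v = ?h' w / \<alpha>"
      using n unfolding nconf_def by (metis (no_types, lifting) dist_0_norm imageE mem_ball)
    then have "?h' v = ?h' w" using \<alpha> by (metis mult.commute norm_zero nonzero_divide_eq_eq zero_neq_one)
    then have "v = w" using n' v w assms(3) by (auto simp: nconf_def inj_on_def)
    then show False using v w by simp
  qed
  with le show ?thesis
    using n n' by (simp add: lrad_def nconf_def)
qed

lemma adm_ball: "adm (ball 0 1)"
  by (simp add: adm_def convex_imp_simply_connected)

lemma lrad_ball: "lrad (ball 0 1) = 0"
proof -
  have "nconf (ball 0 1) (\<lambda>z. z)" by (auto simp: nconf_def)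
  then have "norm_conf_map (ball 0 1) z = z" if "z \<in> ball 0 1" for z
    using nconf_unique[OF _ _ nconf_norm_conf_map[OF adm_ball]] that by auto
  then have "deriv (norm_conf_map (ball 0 1)) 0 = deriv (\<lambda>z. z) 0"
    by (intro deriv_cong_ev) (auto simp: eventually_nhds intro!: exI[of _ "ball 0 1"])
  then show ?thesis by (simp add: lrad_def)
qed

lemma lrad_pos:
  assumes "adm W" "W \<noteq> ball 0 1"
  shows "0 < lrad W"
  using lrad_strict_antimono[OF assms(1) adm_ball] assms by (auto simp: adm_def lrad_ball)

section \<open>Hulls, slit domains and kernel convergence\<close>

text \<open>Connectedness together with the exterior of the disk is what makes the component of 0 in
  the remaining set simply connected, see \<open>adm_slitdom\<close>.\<close>

definition is_hull :: "complex set \<Rightarrow> bool" where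
  "is_hull K \<longleftrightarrow> compact K \<and> 0 \<notin> K \<and> connected (K \<union> - ball 0 1)"

text \<open>The component of 0 is taken because the remaining set may be disconnected: if a profile
  vanishes at several depths, its curve and the mirror image enclose regions cut off from 0.\<close>

definition slitdom :: "complex set \<Rightarrow> complex set" where
  "slitdom K = connected_component_set (ball 0 1 - K) 0"

lemma slitdom_subset: "slitdom K \<subseteq> ball 0 1 - K"
  by (simp add: slitdom_def connected_component_subset)

lemma slitdom_maximal: "connected C \<Longrightarrow> 0 \<in> C \<Longrightarrow> C \<subseteq> ball 0 1 - K \<Longrightarrow> C \<subseteq> slitdom K"
  unfolding slitdom_def by (rule connected_component_maximal)

lemma adm_slitdom:
  assumes "is_hull K"
  shows "adm (slitdom K)"
proof -
  let ?S = "ball 0 1 - K"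
  have S: "open ?S" "0 \<in> ?S" "- ?S = K \<union> - ball 0 1"
    using assms unfolding is_hull_def by (auto intro: open_Diff compact_imp_closed)
  have "slitdom K \<in> components ?S" using S(2) by (auto simp: slitdom_def components_def)
  then have "connected (- slitdom K)"
    using component_complement_connected[of "- ?S" "slitdom K"] assms
    unfolding double_complement by (simp add: S(3) is_hull_def Un_commute)
  moreover have "open (slitdom K)" "connected (slitdom K)"
    using S(1) by (auto simp: slitdom_def open_connected_component)
  moreover have "bounded (slitdom K)" using slitdom_subset
    by (metis Diff_subset bounded_ball bounded_subset)
  ultimately show ?thesis
    using S(2) slitdom_subset[of K]
    by (auto simp: adm_def simply_connected_iff_simple) (auto simp: slitdom_def)
qed

text \<open>The inverse map sends a slightly smaller closed disk onto a compact part of the limit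
  domain. Eventually this part lies in the approximating domains, and the Schwarz lemma then bounds
  their derivatives at 0.\<close>

lemma lrad_upper_semicontinuous:
  assumes K: "is_hull K" and Kn: "\<And>n::nat. is_hull (Kn n)"
    and a: "\<And>C. compact C \<Longrightarrow> C \<subseteq> ball 0 1 - K \<Longrightarrow> eventually (\<lambda>n. C \<inter> Kn n = {}) sequentially"
    and e: "0 < e"
  shows "eventually (\<lambda>n. lrad (slitdom (Kn n)) < lrad (slitdom K) + e) sequentially"
proof -
  let ?W = "slitdom K"
  note W = adm_slitdom[OF K]
  note h = nconf_norm_conf_map[OF W]
  have W': "open ?W" "0 \<in> ?W" using W by (auto simp: adm_def)
  obtain f where f: "f holomorphic_on ball 0 1" "f ` ball 0 1 = ?W" "f 0 = 0"
     "deriv f 0 = 1 / deriv (norm_conf_map ?W) 0"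
    using nconf_inverse[OF h W'] by metis
  \<comment> \<open>Shrinking the disk by this factor costs only \<open>e / 2\<close> in the
    capacity bound, which leaves the strict inequality.\<close>
  define \<rho> where "\<rho> = exp (- e / 2)"
  have \<rho>: "0 < \<rho>" "\<rho> < 1" using e by (auto simp: \<rho>_def)
  have sub: "cball 0 \<rho> \<subseteq> ball (0::complex) 1" using \<rho> by auto
  have cont: "continuous_on (cball 0 \<rho>) f"
    using f(1) sub by (meson continuous_on_subset holomorphic_on_imp_continuous_on)
  let ?C = "f ` cball 0 \<rho>"
  have C: "compact ?C" "connected ?C" "?C \<subseteq> ?W"
    using cont f(2) sub by (auto intro: compact_continuous_image connected_continuous_image)
  have "0 = f 0" "0 \<in> cball 0 \<rho>" using f(3) \<rho> by auto
  then have C0: "0 \<in> ?C" by blast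
  have "eventually (\<lambda>n. ?C \<inter> Kn n = {}) sequentially"
    using a[OF C(1)] C(3) slitdom_subset by blast
  then show ?thesis
  proof eventually_elim
    case (elim n)
    let ?h = "norm_conf_map (slitdom (Kn n))"
    note An = adm_slitdom[OF Kn[of n]]
    note hn = nconf_norm_conf_map[OF An]
    have sub2: "?C \<subseteq> slitdom (Kn n)"
      using C C0 elim slitdom_subset[of K] by (intro slitdom_maximal) auto
    define F where "F = (\<lambda>z::complex. ?h (f (\<rho> * z)))"
    have in_ball: "\<rho> * z \<in> cball 0 \<rho>" if "norm z < 1" for z::complex
      using that \<rho> by (simp add: norm_mult)
    have fhol: "(\<lambda>z. f (\<rho> * z)) holomorphic_on ball 0 1"
      using holomorphic_on_compose_gen[of "\<lambda>z. \<rho> * z" "ball 0 1" f "ball 0 1"] f(1) in_ball sub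
      by (force simp: comp_def intro!: holomorphic_intros)
    have hol: "F holomorphic_on ball 0 1"
      using holomorphic_on_compose_gen[OF fhol, of ?h "slitdom (Kn n)"] hn sub2 in_ball
      unfolding F_def comp_def nconf_def by fastforce
    have F0: "F 0 = 0" using f(3) hn by (simp add: F_def nconf_def)
    have lt: "norm (F z) < 1" if "norm z < 1" for z
      unfolding F_def using sub2 in_ball[OF that] by (intro nconf_norm_less[OF hn]) blast
    have dh: "(?h has_field_derivative deriv ?h 0) (at (f (of_real \<rho> * 0)))"
      using hn An f(3) by (auto simp: nconf_def adm_def intro: holomorphic_derivI)
    have df: "(f has_field_derivative deriv f 0) (at (of_real \<rho> * 0))"
      using f(1) by (auto intro: holomorphic_derivI[where S = "ball 0 1"])
    have "(F has_field_derivative deriv ?h 0 * (deriv f 0 * \<rho>)) (at 0)"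
      unfolding F_def
      by (rule DERIV_chain2[where f = ?h and g = "\<lambda>z. f (of_real \<rho> * z)", OF dh],
          rule DERIV_chain2[where f = f and g = "\<lambda>z. of_real \<rho> * z", OF df])
         (auto intro!: derivative_eq_intros)
    then have "norm (deriv ?h 0 * (deriv f 0 * \<rho>)) \<le> 1"
      using Schwarz_Lemma(2)[OF hol F0 lt, of 0] by (simp add: DERIV_imp_deriv)
    then have "exp (lrad (slitdom (Kn n))) * (\<rho> / exp (lrad ?W)) \<le> 1"
      unfolding f(4) exp_lrad(2)[OF W] exp_lrad(2)[OF An] using \<rho>
      by (simp add: norm_mult norm_divide)
    then have "exp (lrad (slitdom (Kn n))) \<le> exp (lrad ?W) / \<rho>" using \<rho> by (simp add: field_simps)
    also have "\<dots> = exp (lrad ?W + e / 2)" by (simp add: \<rho>_def flip: exp_diff)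
    finally show ?case using e by simp
  qed
qed

text \<open>If the capacities stayed too small along a subsequence, the inverse maps would have
  derivatives at 0 bounded below. A Montel limit \<open>g\<close> is then nonconstant, avoids the
  hull by Hurwitz, and has a derivative too large for the Schwarz lemma on the limit domain.\<close>

lemma lrad_lower_semicontinuous:
  assumes K: "is_hull K" and Kn: "\<And>n::nat. is_hull (Kn n)"
    and b: "\<And>w. w \<in> K \<Longrightarrow> \<exists>x. x \<longlonglongrightarrow> w \<and> (\<forall>n. x n \<in> Kn n \<union> - ball 0 1)"
    and e: "0 < e"
  shows "eventually (\<lambda>n. lrad (slitdom K) - e < lrad (slitdom (Kn n))) sequentially"
proof (rule ccontr)
  let ?W = "slitdom K" and ?l = "\<lambda>n. lrad (slitdom (Kn n))"
  assume "\<not> ?thesis"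
  then obtain s :: "nat \<Rightarrow> nat" where s: "strict_mono s" "\<And>n. \<not> lrad ?W - e < ?l (s n)"
    using not_eventually_sequentiallyD by blast
  note W = adm_slitdom[OF K]
  note h = nconf_norm_conf_map[OF W]
  have "\<exists>f. f holomorphic_on ball 0 1 \<and> f ` ball 0 1 = slitdom (Kn n) \<and> f 0 = 0 \<and>
     deriv f 0 = 1 / deriv (norm_conf_map (slitdom (Kn n))) 0" for n
  proof -
    have "open (slitdom (Kn n))" "0 \<in> slitdom (Kn n)"
      using adm_slitdom[OF Kn[of n]] by (simp_all add: adm_def)
    from nconf_inverse[OF nconf_norm_conf_map[OF adm_slitdom[OF Kn[of n]]] this]
    show ?thesis by metis
  qed
  then obtain f where f: "\<And>n. f n holomorphic_on ball 0 1" "\<And>n. f n ` ball 0 1 = slitdom (Kn n)"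
     "\<And>n. f n 0 = 0" "\<And>n. deriv (f n) 0 = 1 / deriv (norm_conf_map (slitdom (Kn n))) 0"
    by metis
  have df: "deriv (f n) 0 = of_real (exp (- ?l n))" for n
    unfolding f(4) exp_lrad(2)[OF adm_slitdom[OF Kn]] by (simp add: exp_minus inverse_eq_divide)
  let ?H = "range f"
  have bd: "norm (f n z) \<le> 1" if "norm z < 1" for n z
  proof -
    have "f n z \<in> slitdom (Kn n)" using f(2)[of n] that by (metis dist_0_norm image_eqI mem_ball)
    then show ?thesis using slitdom_subset[of "Kn n"] by auto
  qed
  have bdd: "\<exists>B. \<forall>h\<in>?H. \<forall>z\<in>C. norm (h z) \<le> B" if "compact C" "C \<subseteq> ball 0 1" for C
    by (rule exI[of _ 1]) (use bd that in force)
  have hol: "h holomorphic_on ball 0 1" if "h \<in> ?H" for h using that f(1) by blast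
  have "range (f \<circ> s) \<subseteq> ?H" by auto
  then obtain g r where g: "g holomorphic_on ball 0 1" "strict_mono (r :: nat \<Rightarrow> nat)"
      "\<And>x. x \<in> ball 0 1 \<Longrightarrow> ((\<lambda>n. (f \<circ> s) (r n) x) \<longlongrightarrow> g x) sequentially"
      "\<And>K. \<lbrakk>compact K; K \<subseteq> ball 0 1\<rbrakk> \<Longrightarrow> uniform_limit K ((f \<circ> s) \<circ> r) g sequentially"
    using Montel[where \<F> = "f \<circ> s" and \<H> = ?H, OF open_ball hol bdd] by blast
  define q where "q = s \<circ> r"
  have q: "strict_mono q" using s g by (simp add: q_def strict_mono_o)
  have ul: "uniform_limit C (\<lambda>n. f (q n)) g sequentially" if "compact C" "C \<subseteq> ball 0 1" for C
    using g(4)[OF that] by (simp add: q_def comp_def)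
  have g0: "g 0 = 0" using g(3)[of 0] f(3) by (simp add: LIMSEQ_const_iff)
  have sub: "cball 0 (1/2) \<subseteq> ball (0::complex) 1" by auto
  have "uniform_limit (ball 0 (1/2)) (\<lambda>n. f (q n)) g sequentially"
    using ul[OF _ sub] by (rule uniform_limit_on_subset) auto
  then have "(\<lambda>n. deriv (f (q n)) 0) \<longlonglongrightarrow> deriv g 0"
    by (rule deriv_complex_uniform_limit)
       (auto intro!: always_eventually holomorphic_on_subset[OF f(1)])
  then have lim: "(\<lambda>n. norm (deriv (f (q n)) 0)) \<longlonglongrightarrow> norm (deriv g 0)" by (rule tendsto_norm)
  have "exp (- (lrad ?W - e)) \<le> norm (deriv (f (q n)) 0)" for n
    using s(2)[of "r n"] by (simp add: df q_def)
  then have ge: "exp (- (lrad ?W - e)) \<le> norm (deriv g 0)"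
    using lim by (meson LIMSEQ_le_const)
  then have "deriv g 0 \<noteq> 0" by (smt (verit) exp_gt_zero norm_zero)
  have nonconst: "\<not> (\<lambda>z. g z - w) constant_on ball 0 1" for w
  proof
    assume "(\<lambda>z. g z - w) constant_on ball 0 1"
    then obtain c where c: "\<And>z. z \<in> ball 0 1 \<Longrightarrow> g z = c + w"
      unfolding constant_on_def by (metis add.commute diff_add_cancel)
    then have "deriv g 0 = deriv (\<lambda>z. c + w) 0"
      by (intro deriv_cong_ev) (auto simp: eventually_nhds intro!: exI[of _ "ball 0 1"])
    with \<open>deriv g 0 \<noteq> 0\<close> show False by simp
  qed
  \<comment> \<open>Hurwitz with moving targets: \<open>f (q n)\<close> omits
    \<open>x (q n)\<close>, so the limit omits \<open>w\<close>. Targets outside the open disk are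
    admissible because the maps omit them as well.\<close>
  have avoid: "g z \<noteq> w" if z: "z \<in> ball 0 1" and w: "w \<in> K \<union> - ball 0 1" for z w
  proof -
    have "\<exists>x. x \<longlonglongrightarrow> w \<and> (\<forall>n. x n \<in> Kn n \<union> - ball 0 1)"
    proof (cases "w \<in> K")
      case False
      then show ?thesis using w by (intro exI[of _ "\<lambda>_. w"]) auto
    qed (rule b)
    then obtain x where x: "x \<longlonglongrightarrow> w" "\<And>n. x n \<in> Kn n \<union> - ball 0 1" by blast
    have "(\<lambda>n. x (q n)) \<longlonglongrightarrow> w" using LIMSEQ_subseq_LIMSEQ[OF x(1) q] by (simp add: comp_def)
    then have "uniform_limit C (\<lambda>n z. x (q n)) (\<lambda>z. w) sequentially" for C :: "complex set"
      by (auto simp: uniform_limit_iff tendsto_iff)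
    then have ul2: "uniform_limit C (\<lambda>n z. f (q n) z - x (q n)) (\<lambda>z. g z - w) sequentially"
      if "compact C" "C \<subseteq> ball 0 1" for C
      using ul[OF that] by (intro uniform_limit_minus) auto
    have "g z - w \<noteq> 0"
    proof (rule Hurwitz_no_zeros[OF open_ball connected_ball _ _ ul2 nonconst _ z])
      show "(\<lambda>z. f (q n) z - x (q n)) holomorphic_on ball 0 1" for n
        using f(1) by (intro holomorphic_intros) auto
      show "(\<lambda>z. g z - w) holomorphic_on ball 0 1"
        using g(1) by (intro holomorphic_intros) auto
      show "f (q n) z - x (q n) \<noteq> 0" if "z \<in> ball 0 1" for n z
      proof -
        have "f (q n) z \<in> slitdom (Kn (q n))" using f(2) that by blast
        then show ?thesis using x(2)[of "q n"] slitdom_subset[of "Kn (q n)"] by auto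
      qed
    qed
    then show ?thesis by simp
  qed
  have "g ` ball 0 1 \<subseteq> ?W"
  proof (rule slitdom_maximal)
    show "connected (g ` ball 0 1)"
      using g(1) by (intro connected_continuous_image holomorphic_on_imp_continuous_on) auto
    show "0 \<in> g ` ball 0 1" using g0 by (metis centre_in_ball image_eqI zero_less_one)
    show "g ` ball 0 1 \<subseteq> ball 0 1 - K" using avoid by blast
  qed
  then have sub: "g z \<in> ?W" if "norm z < 1" for z using that by auto
  let ?h = "norm_conf_map ?W"
  have hol: "(\<lambda>z. ?h (g z)) holomorphic_on ball 0 1"
    using holomorphic_on_compose_gen[OF g(1), of ?h ?W] h sub
    unfolding comp_def nconf_def by fastforce
  have 0: "?h (g 0) = 0" using g0 h by (simp add: nconf_def)
  have "((\<lambda>z. ?h (g z)) has_field_derivative deriv ?h 0 * deriv g 0) (at 0)"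
  proof (rule DERIV_chain2[where f = ?h])
    show "(?h has_field_derivative deriv ?h 0) (at (g 0))"
      using h W g0 by (auto simp: nconf_def adm_def intro: holomorphic_derivI)
    show "(g has_field_derivative deriv g 0) (at 0)"
      using g(1) by (auto intro: holomorphic_derivI[where S = "ball 0 1"])
  qed
  then have "norm (deriv ?h 0 * deriv g 0) \<le> 1"
    using Schwarz_Lemma(2)[OF hol 0, of 0] nconf_norm_less[OF h sub] by (simp add: DERIV_imp_deriv)
  then have "exp (lrad ?W) * norm (deriv g 0) \<le> 1"
    unfolding exp_lrad(2)[OF W] by (simp add: norm_mult)
  moreover have "exp (lrad ?W) * exp (- (lrad ?W - e)) > 1"
    using e by (simp flip: exp_add)
  moreover have "exp (lrad ?W) * exp (- (lrad ?W - e)) \<le> exp (lrad ?W) * norm (deriv g 0)"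
    using ge by (intro mult_left_mono) auto
  ultimately show False by linarith
qed

text \<open>The part of Caratheodory's kernel theorem needed here.\<close>
lemma lrad_tendsto:
  assumes "is_hull K" "\<And>n::nat. is_hull (Kn n)"
    and "\<And>C. compact C \<Longrightarrow> C \<subseteq> ball 0 1 - K \<Longrightarrow> eventually (\<lambda>n. C \<inter> Kn n = {}) sequentially"
    and "\<And>w. w \<in> K \<Longrightarrow> \<exists>x. x \<longlonglongrightarrow> w \<and> (\<forall>n. x n \<in> Kn n \<union> - ball 0 1)"
  shows "(\<lambda>n. lrad (slitdom (Kn n))) \<longlonglongrightarrow> lrad (slitdom K)"
proof (rule order_tendstoI)
  fix y assume "y < lrad (slitdom K)"
  then show "eventually (\<lambda>n. y < lrad (slitdom (Kn n))) sequentially"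
    using lrad_lower_semicontinuous[OF assms(1,2,4), of "lrad (slitdom K) - y"] by simp
next
  fix y assume "lrad (slitdom K) < y"
  then show "eventually (\<lambda>n. lrad (slitdom (Kn n)) < y) sequentially"
    using lrad_upper_semicontinuous[OF assms(1,2,3), of "y - lrad (slitdom K)"] by simp
qed

section \<open>Boundary behaviour\<close>

text \<open>For a level \<open>M'\<close> strictly between \<open>M\<close> and the value at
  \<open>z\<close>, the superlevel set cannot accumulate at the frontier. It is therefore compact
  and the maximum modulus is attained inside, so \<open>F\<close> is constant, which contradicts the
  bound near any frontier point.\<close>

lemma maximum_modulus_limsup:
  assumes W: "open W" "connected W" "bounded W" and F: "F holomorphic_on W"
    and lim: "\<And>w e. w \<in> frontier W \<Longrightarrow> 0 < e \<Longrightarrow> eventually (\<lambda>z. norm (F z) < M + e) (at w within W)"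
    and z: "z \<in> W"
  shows "norm (F z) \<le> M"
proof (rule ccontr)
  assume "\<not> norm (F z) \<le> M"
  define M' where "M' = (M + norm (F z)) / 2"
  have M': "M < M'" "M' < norm (F z)" using \<open>\<not> norm (F z) \<le> M\<close> by (auto simp: M'_def)
  define S where "S = {w\<in>W. M' \<le> norm (F w)}"
  have contF: "continuous_on W F" using F by (rule holomorphic_on_imp_continuous_on)
  have ev: "eventually (\<lambda>z. norm (F z) < M') (at w within W)" if "w \<in> frontier W" for w
    using lim[OF that, of "M' - M"] M' by simp
  have "closed S"
  proof (subst closed_sequential_limits, intro allI impI)
    fix x l assume x: "(\<forall>n. x n \<in> S) \<and> x \<longlonglongrightarrow> l"
    then have xW: "x n \<in> W" "M' \<le> norm (F (x n))" for n by (auto simp: S_def)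
    have "l \<in> closure W" using x xW closure_sequential by blast
    have "l \<in> W"
    proof (rule ccontr)
      assume "l \<notin> W"
      then have "l \<in> frontier W" using \<open>l \<in> closure W\<close> W(1) by (simp add: frontier_def interior_open)
      have "filterlim x (at l within W) sequentially"
        using x xW \<open>l \<notin> W\<close> by (auto simp: filterlim_at intro!: always_eventually)
      then have "eventually (\<lambda>n. norm (F (x n)) < M') sequentially"
        using eventually_compose_filterlim[OF ev[OF \<open>l \<in> frontier W\<close>]] by blast
      then obtain n where "norm (F (x n)) < M'" using eventually_happens' sequentially_bot by blast
      then show False using xW(2)[of n] by linarith
    qed
    moreover have "(\<lambda>n. norm (F (x n))) \<longlonglongrightarrow> norm (F l)"
      using contF x xW(1) \<open>l \<in> W\<close> by (intro tendsto_norm continuous_on_tendsto_compose[OF contF]) auto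
    then have "M' \<le> norm (F l)" using xW(2) by (meson LIMSEQ_le_const)
    ultimately show "l \<in> S" by (simp add: S_def)
  qed
  moreover have "bounded S" using W(3) by (rule bounded_subset) (auto simp: S_def)
  ultimately have "compact S" by (simp add: compact_eq_bounded_closed)
  have "z \<in> S" using z M' by (simp add: S_def)
  have "continuous_on S (\<lambda>w. norm (F w))"
    using contF by (intro continuous_on_norm) (auto simp: S_def intro: continuous_on_subset)
  then obtain \<xi> where \<xi>: "\<xi> \<in> S" "\<And>w. w \<in> S \<Longrightarrow> norm (F w) \<le> norm (F \<xi>)"
    using continuous_attains_sup[OF \<open>compact S\<close>] \<open>z \<in> S\<close> by blast
  have le: "norm (F w) \<le> norm (F \<xi>)" if "w \<in> W" for w
    using \<xi> that by (cases "w \<in> S") (auto simp: S_def)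
  then have "F constant_on W"
    using maximum_modulus_principle[OF F W(1,2) W(1) order_refl, of \<xi>] \<xi>(1) by (auto simp: S_def)
  then obtain c where c: "\<And>w. w \<in> W \<Longrightarrow> F w = c" by (auto simp: constant_on_def)
  have "W \<noteq> {}" "W \<noteq> UNIV" using z W(3) by auto
  then have "frontier W \<noteq> {}" by (simp add: frontier_eq_empty)
  then obtain w where w: "w \<in> frontier W" by blast
  have "w islimpt W" using w W(1) by (auto simp: frontier_def interior_open closure_def)
  then have "at w within W \<noteq> bot" by (simp add: trivial_limit_within)
  moreover have "eventually (\<lambda>z. z \<in> W) (at w within W)" by (auto simp: eventually_at_filter)
  then have "eventually (\<lambda>z. False) (at w within W)"
    using ev[OF w] by eventually_elim (use c z M' in auto)
  ultimately show False by simp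
qed

text \<open>The map is proper: values in a smaller disk are only taken on a compact subset of \<open>W\<close>.\<close>
lemma norm_conf_map_frontier:
  assumes "adm W" "w \<in> frontier W" "W' \<subseteq> W"
  shows "((\<lambda>z. norm (norm_conf_map W z)) \<longlongrightarrow> 1) (at w within W')"
proof (rule tendsto_within_subset[OF _ assms(3)], rule order_tendstoI)
  let ?h = "norm_conf_map W"
  note h = nconf_norm_conf_map[OF assms(1)]
  have W: "open W" "0 \<in> W" using assms by (auto simp: adm_def)
  fix y :: real assume "1 < y"
  have "eventually (\<lambda>z. z \<in> W) (at w within W)" by (auto simp: eventually_at_filter)
  then show "eventually (\<lambda>z. norm (?h z) < y) (at w within W)"
    by eventually_elim (use nconf_norm_less[OF h] \<open>1 < y\<close> in force)
next
  let ?h = "norm_conf_map W"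
  note h = nconf_norm_conf_map[OF assms(1)]
  have W: "open W" "0 \<in> W" using assms by (auto simp: adm_def)
  fix y :: real assume y: "y < 1"
  obtain g where g: "g holomorphic_on ball 0 1" "g ` ball 0 1 = W" "\<And>z. z \<in> W \<Longrightarrow> g (?h z) = z"
    using nconf_inverse[OF h W] by metis
  have sub: "cball 0 y \<subseteq> ball (0::complex) 1" using y by auto
  then have "compact (g ` cball 0 y)"
    using g(1) by (intro compact_continuous_image) (auto intro: holomorphic_on_imp_continuous_on holomorphic_on_subset)
  then have "open (- (g ` cball 0 y))" by (simp add: compact_imp_closed open_Compl)
  moreover have "w \<notin> W" using assms(2) W(1) by (simp add: frontier_def interior_open)
  then have "w \<in> - (g ` cball 0 y)" using g(2) sub by auto
  ultimately have "eventually (\<lambda>z. z \<in> - (g ` cball 0 y)) (at w within W)"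
    by (meson eventually_at_topological)
  moreover have "eventually (\<lambda>z. z \<in> W) (at w within W)" by (auto simp: eventually_at_filter)
  ultimately show "eventually (\<lambda>z. y < norm (?h z)) (at w within W)"
  proof eventually_elim
    case (elim z)
    show ?case
    proof (rule ccontr)
      assume "\<not> y < norm (?h z)"
      then have "?h z \<in> cball 0 y" by simp
      then show False using elim g(3) by (metis ComplD imageI)
    qed
  qed
qed

text \<open>A frontier point inside the disk and off \<open>K\<close> would have an open component
  meeting \<open>slitdom K\<close>; the two components would coincide, and an open set misses its
  frontier.\<close>

lemma frontier_slitdom:
  assumes "is_hull K"
  shows "frontier (slitdom K) \<subseteq> sphere 0 1 \<union> (K \<inter> ball 0 1)"
proof
  fix w assume w: "w \<in> frontier (slitdom K)"
  let ?S = "ball 0 1 - K"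
  have S: "open ?S" using assms unfolding is_hull_def by (auto intro: open_Diff compact_imp_closed)
  have "slitdom K \<subseteq> cball 0 1" using slitdom_subset[of K] by auto
  then have "closure (slitdom K) \<subseteq> cball 0 1" by (meson closed_cball closure_minimal)
  then have w1: "norm w \<le> 1" using w by (auto simp: frontier_def)
  have op: "open (slitdom K)" using adm_slitdom[OF assms] by (simp add: adm_def)
  then have wn: "w \<notin> slitdom K" using w by (simp add: frontier_def interior_open)
  have "w \<notin> ?S"
  proof
    assume wS: "w \<in> ?S"
    let ?C = "connected_component_set ?S w"
    have "open ?C" "w \<in> ?C" using S wS by (auto simp: open_connected_component)
    then obtain v where v: "v \<in> ?C" "v \<in> slitdom K"
      using w open_Int_closure_eq_empty[of ?C "slitdom K"] unfolding frontier_def by blast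
    then have "?C = slitdom K" unfolding slitdom_def
      by (metis connected_component_eq)
    then show False using wn \<open>w \<in> ?C\<close> by simp
  qed
  then show "w \<in> sphere 0 1 \<union> (K \<inter> ball 0 1)" using w1 by auto
qed

text \<open>The logarithm of its modulus is the harmonic function on \<open>W\<close> with boundary
  values \<open>- ln (norm w)\<close>. Its value at 0 is the capacity, so inequalities between
  capacities become inequalities on the boundary. The case distinction fills the removable
  singularity.\<close>

definition cquot :: "complex set \<Rightarrow> complex \<Rightarrow> complex" where
  "cquot W z = (if z = 0 then deriv (norm_conf_map W) 0 else norm_conf_map W z / z)"

lemma
  assumes "adm W"
  shows cquot_holomorphic: "cquot W holomorphic_on W"
    and cquot_ge_1: "z \<in> W \<Longrightarrow> 1 \<le> norm (cquot W z)"
    and cquot_le: "z \<in> W \<Longrightarrow> z \<noteq> 0 \<Longrightarrow> norm (cquot W z) \<le> 1 / norm z"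
    and cquot_0: "norm (cquot W 0) = exp (lrad W)"
proof -
  note h = nconf_norm_conf_map[OF assms(1)]
  have W: "open W" "0 \<in> W" using assms by (auto simp: adm_def)
  show "cquot W holomorphic_on W"
  proof (rule pole_theorem_open_0[where g = "norm_conf_map W" and a = 0])
    show "norm_conf_map W holomorphic_on W" "norm_conf_map W 0 = 0"
      using h by (simp_all add: nconf_def)
  qed (use W in \<open>simp_all add: cquot_def\<close>)
  show c0: "norm (cquot W 0) = exp (lrad W)"
    unfolding cquot_def exp_lrad(2)[OF assms] by simp
  show "1 \<le> norm (cquot W z)" if "z \<in> W"
    using norm_conf_map_norm_ge[OF assms that] c0 lrad_nonneg[OF assms]
    by (cases "z = 0") (auto simp: cquot_def norm_divide divide_simps)
  show "norm (cquot W z) \<le> 1 / norm z" if "z \<in> W" "z \<noteq> 0"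
    using nconf_norm_less[OF h that(1)] that by (simp add: cquot_def norm_divide divide_right_mono)
qed

lemma cquot_frontier:
  assumes "adm W" "w \<in> frontier W" "W' \<subseteq> W"
  shows "((\<lambda>z. norm (cquot W z)) \<longlongrightarrow> 1 / norm w) (at w within W')"
proof -
  have W: "open W" "0 \<in> W" using assms by (auto simp: adm_def)
  then have w: "w \<noteq> 0" using assms(2) by (auto simp: frontier_def interior_open)
  have "((\<lambda>z. norm (norm_conf_map W z) / norm z) \<longlongrightarrow> 1 / norm w) (at w within W')"
    using norm_conf_map_frontier[OF assms] w by (intro tendsto_intros) auto
  moreover have "eventually (\<lambda>z. norm (norm_conf_map W z) / norm z = norm (cquot W z)) (at w within W')"
    using w by (auto simp: cquot_def norm_divide eventually_at intro!: exI[of _ "norm w"] simp: dist_norm)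
  ultimately show ?thesis by (rule Lim_transform_eventually)
qed

section \<open>Slits in polar coordinates\<close>

text \<open>The parameter \<open>u\<close> is the depth below the circle, so the norm of a point
  determines its parameter; this makes membership and the topology of the complement explicit in
  polar coordinates.\<close>

definition pcurve :: "(real \<Rightarrow> real) \<Rightarrow> real \<Rightarrow> complex set" where
  "pcurve \<phi> s = (\<lambda>u. of_real (1 - u) * cis (\<phi> u)) ` {0..s}"

definition pcurve2 :: "(real \<Rightarrow> real) \<Rightarrow> real \<Rightarrow> complex set" where
  "pcurve2 \<phi> s = pcurve \<phi> s \<union> pcurve (\<lambda>u. - \<phi> u) s"

lemma connected_polar_image:
  fixes a :: "real \<Rightarrow> real \<Rightarrow> real"
  assumes "continuous_on ({0..<1} \<times> I) (\<lambda>p. a (fst p) (snd p))" "connected I"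
  shows "connected ((\<lambda>p. of_real (fst p) * cis (a (fst p) (snd p))) ` ({0..<1} \<times> I))"
  using assms
  by (intro connected_continuous_image connected_Times) (auto intro!: continuous_intros)

lemma connected_polar_image_Un_ball:
  fixes a :: "real \<Rightarrow> real \<Rightarrow> real"
  assumes "connected I" "I \<noteq> {}" "continuous_on ({0..<1} \<times> I) (\<lambda>p. a (fst p) (snd p))"
    and that: "0 \<le> s" "s < 1"
  shows "connected ((\<lambda>p. of_real (fst p) * cis (a (fst p) (snd p))) ` ({0..<1::real} \<times> I) \<union> ball 0 (1 - s))"
proof (rule connected_Un[OF connected_polar_image[OF assms(3,1)] connected_ball])
  obtain x where "x \<in> I" using assms(2) by blast
  then have "0 \<in> (\<lambda>p. of_real (fst p) * cis (a (fst p) (snd p))) ` ({0..<1::real} \<times> I)"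
    by (intro image_eqI[where x = "(0, x)"]) simp_all
  moreover have "0 \<in> ball (0::complex) (1 - s)" using that by simp
  ultimately show "(\<lambda>p. of_real (fst p) * cis (a (fst p) (snd p))) ` ({0..<1::real} \<times> I) \<inter> ball 0 (1 - s) \<noteq> {}"
    by blast
qed

lemma pcurve_norm: "w \<in> pcurve \<phi> s \<Longrightarrow> s < 1 \<Longrightarrow> 1 - s \<le> norm w"
  by (auto simp: pcurve_def norm_mult simp del: of_real_diff)

lemma mem_pcurve_iff:
  assumes "s < 1"
  shows "w \<in> pcurve \<phi> s \<longleftrightarrow> 1 - s \<le> norm w \<and> norm w \<le> 1 \<and> w = of_real (norm w) * cis (\<phi> (1 - norm w))"
proof
  assume "w \<in> pcurve \<phi> s"
  then obtain u where u: "0 \<le> u" "u \<le> s" "w = of_real (1 - u) * cis (\<phi> u)" by (auto simp: pcurve_def)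
  then have n: "norm w = 1 - u" using assms by (simp add: norm_mult del: of_real_diff)
  show "1 - s \<le> norm w \<and> norm w \<le> 1 \<and> w = of_real (norm w) * cis (\<phi> (1 - norm w))"
    unfolding n using u by simp
next
  assume "1 - s \<le> norm w \<and> norm w \<le> 1 \<and> w = of_real (norm w) * cis (\<phi> (1 - norm w))"
  then show "w \<in> pcurve \<phi> s" unfolding pcurve_def by (intro image_eqI[of _ _ "1 - norm w"]) auto
qed

text \<open>On each circle about 0 that the slit meets, one angle is removed. The complement is the
  continuous image of a rectangle of radii and remaining angles, together with the central disk that
  the slit does not reach.\<close>

lemma connected_ball_minus_pcurve:
  assumes "continuous_on {0..1} \<phi>" "0 \<le> s" "s < 1"
  shows "connected (ball 0 1 - pcurve \<phi> s)"
proof -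
  let ?f = "\<lambda>p. of_real (fst p) * cis (\<phi> (1 - fst p) + snd p)"
  have "ball 0 1 - pcurve \<phi> s = ?f ` ({0..<1} \<times> {0<..<2*pi}) \<union> ball 0 (1 - s)" (is "_ = ?R")
  proof (intro equalityI subsetI)
    fix z assume "z \<in> ball 0 1 - pcurve \<phi> s"
    then have z: "norm z < 1" "z \<notin> pcurve \<phi> s" by auto
    show "z \<in> ?R"
    proof (cases "norm z < 1 - s")
      case False
      then have nz: "z \<noteq> 0" using assms by auto
      \<comment> \<open>Rotating by \<open>- \<phi>\<close> puts the removed point of the circle at
        angle 0.\<close>
      define w where "w = z / (of_real (norm z) * cis (\<phi> (1 - norm z)))"
      have "norm w = 1" using nz by (simp add: w_def norm_divide norm_mult)
      then have w: "w = cis (Arg2pi w)" by (metis Arg2pi_eq cis_conv_exp mult_1 of_real_1)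
      have zw: "z = of_real (norm z) * cis (\<phi> (1 - norm z)) * w" using nz by (simp add: w_def)
      have "Arg2pi w \<noteq> 0"
      proof
        assume "Arg2pi w = 0"
        then have "w = 1" using w by simp
        then have "z \<in> pcurve \<phi> s" using zw False z assms by (subst mem_pcurve_iff) auto
        with z show False by simp
      qed
      then have "(norm z, Arg2pi w) \<in> {0..<1} \<times> {0<..<2*pi}"
        using z Arg2pi[of w] by auto
      moreover have "z = ?f (norm z, Arg2pi w)"
        using zw w by (simp add: cis_mult[symmetric] mult.assoc)
      ultimately show ?thesis by blast
    qed simp
  next
    fix z assume "z \<in> ?R"
    then consider r x where "0 \<le> r" "r < 1" "0 < x" "x < 2*pi" "z = of_real r * cis (\<phi> (1 - r) + x)"
      | "norm z < 1 - s" by auto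
    then show "z \<in> ball 0 1 - pcurve \<phi> s"
    proof cases
      case 1
      then have n: "norm z = r" by (simp add: norm_mult)
      have "z \<notin> pcurve \<phi> s"
      proof
        assume "z \<in> pcurve \<phi> s"
        then have *: "1 - s \<le> r" "z = of_real r * cis (\<phi> (1 - r))" using n by (simp_all add: mem_pcurve_iff assms)
        then have "cis x = 1" using 1 assms by (auto simp: cis_mult[symmetric])
        then have "cos x = 1" by (metis cis.simps(1) one_complex.simps(1))
        then show False using 1 cos_one_2pi_int[of x]
          by (auto simp: zero_less_mult_iff)
      qed
      then show ?thesis using 1 n by simp
    next
      case 2
      then show ?thesis using pcurve_norm[of z \<phi> s] assms by auto
    qed
  qed
  also have "connected \<dots>"
    using assms pi_gt_zero
    by (intro connected_polar_image_Un_ball) (auto intro!: continuous_intros continuous_on_compose2[OF assms(1)] simp del: pi_gt_zero)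
  finally show ?thesis .
qed

text \<open>The slits bound two twisted sectors, a thin one around the angle 0 and a wide one around
  pi; the central disk joins them.\<close>

lemma connected_ball_minus_pcurve2:
  assumes "continuous_on {0..1} \<phi>" "0 \<le> s" "s < 1" and \<phi>: "\<And>u. 0 < u \<Longrightarrow> u \<le> 1 \<Longrightarrow> 0 < \<phi> u \<and> \<phi> u \<le> 1"
  shows "connected (ball 0 1 - pcurve2 \<phi> s)"
proof -
  let ?f = "\<lambda>p. of_real (fst p) * cis (\<phi> (1 - fst p) + snd p * (2 * pi - 2 * \<phi> (1 - fst p)))"
  let ?g = "\<lambda>p. of_real (fst p) * cis (snd p * \<phi> (1 - fst p))"
  let ?R1 = "?f ` ({0..<1} \<times> {0<..<1}) \<union> ball 0 (1 - s)"
  let ?R2 = "?g ` ({0..<1} \<times> {-1<..<1}) \<union> ball 0 (1 - s)"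
  have pi: "1 < pi" using pi_gt3 by simp
  have mem: "w \<in> pcurve2 \<phi> s \<longleftrightarrow> 1 - s \<le> norm w \<and> norm w \<le> 1 \<and>
     (w = of_real (norm w) * cis (\<phi> (1 - norm w)) \<or> w = of_real (norm w) * cis (- \<phi> (1 - norm w)))" for w
    unfolding pcurve2_def Un_iff mem_pcurve_iff[OF assms(3)] by blast
  have avoid: "of_real r * cis y \<in> ball 0 1 - pcurve2 \<phi> s"
    if r: "0 \<le> r" "r < 1" and y: "\<bar>y\<bar> < \<phi> (1 - r) \<or> \<phi> (1 - r) < y \<and> y < 2 * pi - \<phi> (1 - r)" for r y
  proof -
    have n: "norm (of_real r * cis y) = r" using r by (simp add: norm_mult)
    have p: "0 < \<phi> (1 - r)" "\<phi> (1 - r) \<le> 1" using \<phi>[of "1 - r"] r by auto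
    \<comment> \<open>Both slits sit at angles with cosine \<open>cos (\<phi> (1 - r))\<close>, so
      one comparison of cosines avoids them together.\<close>
    have cosy: "cos y \<noteq> cos (\<phi> (1 - r))"
    proof -
      have "cos (\<phi> (1 - r)) < cos y" if "\<bar>y\<bar> < \<phi> (1 - r)"
        using cos_monotone_0_pi[of "\<bar>y\<bar>" "\<phi> (1 - r)"] that p pi by simp
      moreover have "cos y < cos (\<phi> (1 - r))" if "\<phi> (1 - r) < y" "y \<le> pi"
        using cos_monotone_0_pi[of "\<phi> (1 - r)" y] that p pi by simp
      moreover have "cos y < cos (\<phi> (1 - r))" if "pi < y" "y < 2 * pi - \<phi> (1 - r)"
        using cos_monotone_0_pi[of "\<phi> (1 - r)" "2 * pi - y"] that p pi by (simp add: cos_diff)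
      ultimately show ?thesis using y by fastforce
    qed
    have "of_real r * cis y \<notin> pcurve2 \<phi> s"
    proof
      assume "of_real r * cis y \<in> pcurve2 \<phi> s"
      then have *: "1 - s \<le> r" "of_real r * cis y = of_real r * cis (\<phi> (1 - r)) \<or> of_real r * cis y = of_real r * cis (- \<phi> (1 - r))"
        unfolding mem n by auto
      then have "cis y = cis (\<phi> (1 - r)) \<or> cis y = cis (- \<phi> (1 - r))" using assms(3) by auto
      then have "cos y = cos (\<phi> (1 - r))" by (metis cis.simps(1) cos_minus)
      with cosy show False by simp
    qed
    then show ?thesis using n r by simp
  qed
  have "ball 0 1 - pcurve2 \<phi> s = ?R1 \<union> ?R2"
  proof (intro equalityI subsetI)
    fix z assume "z \<in> ball 0 1 - pcurve2 \<phi> s"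
    then have z: "norm z < 1" "z \<notin> pcurve2 \<phi> s" by auto
    show "z \<in> ?R1 \<union> ?R2"
    proof (cases "norm z < 1 - s")
      case False
      define r where "r = norm z"
      define p where "p = \<phi> (1 - r)"
      have r: "r < 1" "0 < r" "1 - s \<le> r" using z False assms by (auto simp: r_def)
      have p: "0 < p" "p \<le> 1" using \<phi>[of "1 - r"] r by (auto simp: p_def)
      have zr: "z = of_real r * cis (Arg z)" unfolding r_def
        using rcis_cmod_Arg[of z] by (simp add: rcis_def)
      have A: "- pi < Arg z" "Arg z \<le> pi" using Arg_bounded by auto
      have ne: "Arg z \<noteq> p" "Arg z \<noteq> - p"
        using z(2) r zr unfolding mem by (auto simp: r_def p_def)
      have R1: "z \<in> ?R1" if y: "z = of_real r * cis y" "p < y" "y < 2 * pi - p" for y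
      proof -
        define l where "l = (y - p) / (2 * pi - 2 * p)"
        have d: "0 < 2 * pi - 2 * p" using p pi by simp
        then have "0 < l" "l < 1" using y by (auto simp: l_def)
        moreover have "y = p + l * (2 * pi - 2 * p)" using d by (simp add: l_def)
        then have "z = ?f (r, l)" using y(1) by (simp add: p_def)
        ultimately show ?thesis using r by (intro UnI1 image_eqI[of _ _ "(r, l)"]) auto
      qed
      consider "\<bar>Arg z\<bar> < p" | "p < Arg z" | "Arg z < - p" using ne by linarith
      then show ?thesis
      proof cases
        case 1
        then have "z = ?g (r, Arg z / p)" using zr p by (simp flip: p_def)
        moreover have "- p < Arg z" "Arg z < p" using 1 by linarith+
        then have "- 1 < Arg z / p" "Arg z / p < 1"
          using p by (simp_all add: less_divide_eq divide_less_eq)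
        then have "(r, Arg z / p) \<in> {0..<1} \<times> {-1<..<1}" using r by auto
        ultimately show ?thesis by blast
      next
        case 2
        then show ?thesis using R1[OF zr] A p pi by auto
      next
        case 3
        have "z = of_real r * cis (Arg z + 2 * pi)" by (subst zr) (simp add: cis_mult[symmetric] del: cis_mult)
        then show ?thesis using R1[of "Arg z + 2 * pi"] A p pi 3 by auto
      qed
    qed simp
  next
    fix z assume "z \<in> ?R1 \<union> ?R2"
    then consider r l where "0 \<le> r" "r < 1" "0 < l" "l < 1" "z = ?f (r, l)"
      | r l where "0 \<le> r" "r < 1" "-1 < l" "l < 1" "z = ?g (r, l)"
      | "norm z < 1 - s" by fastforce
    then show "z \<in> ball 0 1 - pcurve2 \<phi> s"
    proof cases
      case 1
      define p where "p = \<phi> (1 - r)"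
      have p: "0 < p" "p \<le> 1" using \<phi>[of "1 - r"] 1 by (auto simp: p_def)
      have "0 < l * (2 * pi - 2 * p)" "l * (2 * pi - 2 * p) < 1 * (2 * pi - 2 * p)"
        using 1 p pi by (intro mult_pos_pos mult_strict_right_mono; simp)+
      then show ?thesis unfolding 1(5) fst_conv snd_conv
        by (intro avoid[OF 1(1,2)]) (auto simp flip: p_def)
    next
      case 2
      define p where "p = \<phi> (1 - r)"
      have p: "0 < p" using \<phi>[of "1 - r"] 2 by (auto simp: p_def)
      have "\<bar>l\<bar> * p < 1 * p" using 2 p by (intro mult_strict_right_mono) auto
      then have "\<bar>l * p\<bar> < p" using p by (simp add: abs_mult)
      then show ?thesis unfolding 2(5) fst_conv snd_conv
        by (intro avoid[OF 2(1,2)]) (auto simp flip: p_def)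
    next
      case 3
      then show ?thesis using mem[of z] assms by auto
    qed
  qed
  moreover have "connected (?R1 \<union> ?R2)"
  proof (rule connected_Un)
    show "connected ?R1" "connected ?R2"
      using assms by (intro connected_polar_image_Un_ball; auto intro!: continuous_intros continuous_on_compose2[OF assms(1)])+
    have "0 \<in> ball (0::complex) (1 - s)" using assms by simp
    then show "?R1 \<inter> ?R2 \<noteq> {}" by blast
  qed
  ultimately show ?thesis by simp
qed

lemma is_hull_pcurve:
  assumes "continuous_on {0..s} \<phi>" "0 \<le> s" "s < 1"
  shows "is_hull (pcurve \<phi> s)"
proof -
  have c: "continuous_on {0..s} (\<lambda>u. of_real (1 - u) * cis (\<phi> u))"
    using assms(1) by (auto intro!: continuous_intros)
  have "connected (pcurve \<phi> s \<union> - ball 0 1)"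
  proof (rule connected_Un)
    show "connected (pcurve \<phi> s)" unfolding pcurve_def using c by (rule connected_continuous_image) simp
    show "connected (- ball 0 1 :: complex set)"
      by (intro connected_complement_bounded_convex) auto
    have "cis (\<phi> 0) \<in> pcurve \<phi> s \<inter> - ball 0 1"
      using assms(2) by (auto simp: pcurve_def intro!: image_eqI[of _ _ 0])
    then show "pcurve \<phi> s \<inter> - ball 0 1 \<noteq> {}" by blast
  qed
  moreover have "compact (pcurve \<phi> s)" unfolding pcurve_def using c by (rule compact_continuous_image) simp
  moreover have "0 \<notin> pcurve \<phi> s" using pcurve_norm[of 0 \<phi> s] assms by auto
  ultimately show ?thesis by (simp add: is_hull_def)
qed

lemma is_hull_Un:
  assumes "is_hull A" "is_hull B"
  shows "is_hull (A \<union> B)"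
proof -
  have "connected ((A \<union> - ball 0 1) \<union> (B \<union> - ball 0 1))"
  proof (rule connected_Un)
    have "(1::complex) \<in> (A \<union> - ball 0 1) \<inter> (B \<union> - ball 0 1)" by simp
    then show "(A \<union> - ball 0 1) \<inter> (B \<union> - ball 0 1) \<noteq> {}" by blast
  qed (use assms in \<open>auto simp: is_hull_def\<close>)
  moreover have "(A \<union> - ball 0 1) \<union> (B \<union> - ball 0 1) = A \<union> B \<union> - ball 0 1" by blast
  ultimately show ?thesis using assms by (simp add: is_hull_def compact_Un)
qed

lemma is_hull_pcurve2:
  assumes "continuous_on {0..s} \<phi>" "0 \<le> s" "s < 1"
  shows "is_hull (pcurve2 \<phi> s)"
  unfolding pcurve2_def using assms by (intro is_hull_Un is_hull_pcurve continuous_intros) auto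

lemma slitdom_eq:
  assumes "is_hull K" "connected (ball 0 1 - K)"
  shows "slitdom K = ball 0 1 - K"
proof (rule antisym[OF slitdom_subset])
  show "ball 0 1 - K \<subseteq> slitdom K"
    using assms by (intro slitdom_maximal) (auto simp: is_hull_def)
qed

lemma slitdom_pcurve:
  assumes "continuous_on {0..1} \<phi>" "0 \<le> s" "s < 1"
  shows "slitdom (pcurve \<phi> s) = ball 0 1 - pcurve \<phi> s"
  using assms by (intro slitdom_eq is_hull_pcurve connected_ball_minus_pcurve)
     (auto intro: continuous_on_subset)

lemma lrad_cnj:
  assumes "adm W" "adm (cnj ` W)"
  shows "lrad (cnj ` W) = lrad W"
proof -
  let ?h = "norm_conf_map W" and ?g = "\<lambda>z. cnj (norm_conf_map W (cnj z))"
  note h = nconf_norm_conf_map[OF assms(1)]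
  have W: "open W" "0 \<in> W" "open (cnj ` W)" "0 \<in> cnj ` W" using assms by (auto simp: adm_def)
  have im: "cnj ` cnj ` W = W" by (auto simp: image_image)
  have hol: "?g holomorphic_on cnj ` W"
    using holomorphic_on_compose_cnj_cnj[of ?h "cnj ` W"] h W unfolding im comp_def nconf_def by auto
  have "?g ` cnj ` W = cnj ` (?h ` W)" by (auto simp: image_image)
  also have "?h ` W = ball 0 1" using h by (simp add: nconf_def)
  also have "cnj ` ball 0 1 = ball 0 1"
  proof
    show "ball 0 1 \<subseteq> cnj ` ball 0 1"
    proof
      fix z :: complex assume "z \<in> ball 0 1"
      then show "z \<in> cnj ` ball 0 1" by (intro image_eqI[of _ _ "cnj z"]) auto
    qed
  qed auto
  finally have img: "?g ` cnj ` W = ball 0 1" .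
  have inj: "inj_on ?g (cnj ` W)"
    using h unfolding nconf_def by (auto simp: inj_on_def)
  have d: "deriv ?g 0 = deriv ?h 0"
  proof -
    have "(?h has_field_derivative deriv ?h 0) (at (cnj 0))"
      using h W by (auto simp: nconf_def intro: holomorphic_derivI)
    then have "(cnj \<circ> ?h \<circ> cnj has_field_derivative cnj (deriv ?h 0)) (at 0)"
      by (rule has_field_derivative_cnj_cnj)
    moreover have "cnj (deriv ?h 0) = deriv ?h 0" using h by (simp add: nconf_def Reals_cnj_iff)
    ultimately show ?thesis by (simp add: DERIV_imp_deriv comp_def)
  qed
  have "nconf (cnj ` W) ?g" using hol img inj h by (simp add: nconf_def d)
  then have "?g z = norm_conf_map (cnj ` W) z" if "z \<in> cnj ` W" for z
    using nconf_unique[OF W(3,4) _ nconf_norm_conf_map[OF assms(2)] that] by blast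
  then have "deriv ?g 0 = deriv (norm_conf_map (cnj ` W)) 0"
    using W by (intro deriv_cong_ev) (auto simp: eventually_nhds)
  then show ?thesis by (simp add: lrad_def d)
qed

section \<open>Capacity of two radial slits\<close>

lemma slitdom_antimono: "A \<subseteq> B \<Longrightarrow> slitdom B \<subseteq> slitdom A"
  unfolding slitdom_def by (intro connected_component_mono) blast

lemma tendsto_upper_bound_eventually:
  fixes f g :: "'a \<Rightarrow> real"
  assumes "(g \<longlongrightarrow> l) F" "l \<le> M" "eventually (\<lambda>z. f z \<le> g z) F" "0 < e"
  shows "eventually (\<lambda>z. f z < M + e) F"
proof -
  have "eventually (\<lambda>z. g z < M + e) F" using assms by (intro order_tendstoD(2)[OF assms(1)]) simp
  with assms(3) show ?thesis by eventually_elim simp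
qed

text \<open>Maximum principle for \<open>(q\<^sub>A q\<^sub>B)\<^sup>2 / q\<^sup>3\<close>, where \<open>q\<close> belongs to the union.\<close>
lemma lrad_Un_ge:
  assumes A: "is_hull A" and B: "is_hull B"
    and AB: "\<And>w. w \<in> A \<inter> ball 0 1 \<Longrightarrow> w \<in> slitdom B \<and> (norm (cquot (slitdom B) w))\<^sup>2 \<le> 1 / norm w"
    and BA: "\<And>w. w \<in> B \<inter> ball 0 1 \<Longrightarrow> w \<in> slitdom A \<and> (norm (cquot (slitdom A) w))\<^sup>2 \<le> 1 / norm w"
  shows "2 * (lrad (slitdom A) + lrad (slitdom B)) \<le> 3 * lrad (slitdom (A \<union> B))"
proof -
  let ?W = "slitdom (A \<union> B)"
  let ?qA = "cquot (slitdom A)" and ?qB = "cquot (slitdom B)" and ?q = "cquot ?W"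
  note dA = adm_slitdom[OF A] and dB = adm_slitdom[OF B] and d = adm_slitdom[OF is_hull_Un[OF A B]]
  have sub: "?W \<subseteq> slitdom A" "?W \<subseteq> slitdom B" by (auto intro!: slitdom_antimono)
  have W: "open ?W" "0 \<in> ?W" "?W \<subseteq> ball 0 1" using d by (auto simp: adm_def)
  have W': "connected ?W" "bounded ?W"
    using adm_imp_connected[OF d] W(3) bounded_subset[OF bounded_ball] by auto
  \<comment> \<open>The exponents balance on the slits. On \<open>A\<close>, \<open>?qA\<close> has
    modulus at most \<open>1 / norm z\<close> and the modulus of \<open>?q\<close> tends to
    \<open>1 / norm w\<close>, so the limiting bound is
    \<open>norm w * (norm (?qB w))\<^sup>2\<close>, at most 1 by hypothesis; on \<open>B\<close> the
    roles swap. Near the circle \<open>?qA\<close> and \<open>?qB\<close> have modulus at most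
    \<open>1 / norm z\<close> and \<open>?q\<close> has modulus at least 1.\<close>
  define F where "F = (\<lambda>z. (?qA z * ?qB z)\<^sup>2 / ?q z ^ 3)"
  have q1: "1 \<le> norm (?q z)" if "z \<in> ?W" for z using cquot_ge_1[OF d that] .
  then have q0: "?q z \<noteq> 0" if "z \<in> ?W" for z using that by fastforce
  have hol: "F holomorphic_on ?W"
    unfolding F_def using cquot_holomorphic[OF dA] cquot_holomorphic[OF dB] cquot_holomorphic[OF d] q0
    by (auto intro!: holomorphic_intros intro: holomorphic_on_subset[OF _ sub(1)] holomorphic_on_subset[OF _ sub(2)])
  have nF: "norm (F z) = (norm (?qA z) * norm (?qB z))\<^sup>2 / norm (?q z) ^ 3" for z
    by (simp add: F_def norm_divide norm_mult norm_power)
  have evW: "eventually (\<lambda>z. z \<in> ?W) (at w within ?W)" for w by (auto simp: eventually_at_filter)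
  have ev0: "eventually (\<lambda>z. z \<noteq> 0) (at w within ?W)" if "w \<noteq> 0" for w :: complex
    using t1_space_nhds[OF that] by (auto simp: eventually_at_filter elim: eventually_mono)
  have slit: "eventually (\<lambda>z. norm (F z) < 1 + e) (at w within ?W)"
    if w: "w \<in> X \<inter> ball 0 1" "w \<in> frontier ?W" and e: "0 < e"
      and X: "adm (slitdom X)" "adm (slitdom Y)" "?W \<subseteq> slitdom X" "?W \<subseteq> slitdom Y"
      and Y: "w \<in> slitdom Y" "(norm (cquot (slitdom Y) w))\<^sup>2 \<le> 1 / norm w"
      and n: "\<And>z. norm (F z) = (norm (cquot (slitdom X) z) * norm (cquot (slitdom Y) z))\<^sup>2 / norm (?q z) ^ 3"
    for w e X Y
  proof -
    have w0: "w \<noteq> 0" using w(2) W by (auto simp: frontier_def interior_open)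
    let ?G = "\<lambda>z. (1 / norm z * norm (cquot (slitdom Y) z))\<^sup>2 / norm (?q z) ^ 3"
    have "isCont (cquot (slitdom Y)) w"
      using cquot_holomorphic[OF X(2)] Y(1) X(2)
      by (metis adm_def continuous_on_eq_continuous_at holomorphic_on_imp_continuous_on)
    then have "(cquot (slitdom Y) \<longlongrightarrow> cquot (slitdom Y) w) (at w within ?W)"
      by (simp add: continuous_at_imp_continuous_at_within continuous_within[symmetric])
    then have "(?G \<longlongrightarrow> (1 / norm w * norm (cquot (slitdom Y) w))\<^sup>2 / (1 / norm w) ^ 3) (at w within ?W)"
      using cquot_frontier[OF d w(2) order_refl] w0 by (intro tendsto_intros) auto
    moreover have "(1 / norm w * norm (cquot (slitdom Y) w))\<^sup>2 / (1 / norm w) ^ 3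
        = norm w * (norm (cquot (slitdom Y) w))\<^sup>2" using w0
      by (simp add: power2_eq_square power3_eq_cube field_simps)
    moreover have "norm w * (norm (cquot (slitdom Y) w))\<^sup>2 \<le> 1"
      using mult_left_mono[OF Y(2), of "norm w"] w0 by simp
    moreover have "eventually (\<lambda>z. norm (F z) \<le> ?G z) (at w within ?W)"
      using evW ev0[OF w0]
    proof eventually_elim
      case (elim z)
      have "norm (cquot (slitdom X) z) \<le> 1 / norm z" using cquot_le[OF X(1)] elim X(3) by blast
      then show ?case unfolding n
        by (intro divide_right_mono power_mono mult_right_mono) auto
    qed
    ultimately show ?thesis using e by (intro tendsto_upper_bound_eventually[of ?G]) auto
  qed
  have "norm (F 0) \<le> 1"
  proof (rule maximum_modulus_limsup[OF W(1) W' hol _ W(2)])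
    fix w and e :: real assume w: "w \<in> frontier ?W" and e: "0 < e"
    consider "norm w = 1" | "w \<in> A \<inter> ball 0 1" | "w \<in> B \<inter> ball 0 1"
      using frontier_slitdom[OF is_hull_Un[OF A B]] w by auto
    then show "eventually (\<lambda>z. norm (F z) < 1 + e) (at w within ?W)"
    proof cases
      case 1
      then have w0: "w \<noteq> 0" by auto
      have "((\<lambda>z. (1 / norm z * (1 / norm z))\<^sup>2) \<longlongrightarrow> (1 / norm w * (1 / norm w))\<^sup>2) (at w within ?W)"
        using 1 by (intro tendsto_intros) auto
      moreover have "eventually (\<lambda>z. norm (F z) \<le> (1 / norm z * (1 / norm z))\<^sup>2) (at w within ?W)"
        using evW ev0[OF w0]
      proof eventually_elim
        case (elim z)
        have "norm (?qA z) \<le> 1 / norm z" "norm (?qB z) \<le> 1 / norm z"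
          using cquot_le[OF dA] cquot_le[OF dB] elim sub by blast+
        then have "(norm (?qA z) * norm (?qB z))\<^sup>2 \<le> (1 / norm z * (1 / norm z))\<^sup>2"
          by (intro power_mono mult_mono) auto
        moreover have "1 \<le> norm (?q z) ^ 3" using q1 elim by simp
        ultimately show ?case unfolding nF
          by (smt (verit) divide_le_eq mult_left_le zero_le_power2 mult_le_cancel_left1)
      qed
      ultimately show ?thesis using e 1 by (intro tendsto_upper_bound_eventually) auto
    next
      case 2
      show ?thesis by (rule slit[OF 2 w e dA dB sub _ _ nF]) (use AB[OF 2] in auto)
    next
      case 3
      show ?thesis by (rule slit[OF 3 w e dB dA sub(2,1)]) (use BA[OF 3] nF in \<open>auto simp: mult.commute\<close>)
    qed
  qed
  then have "(exp (lrad (slitdom A)) * exp (lrad (slitdom B)))\<^sup>2 \<le> exp (lrad ?W) ^ 3"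
    unfolding nF cquot_0[OF dA] cquot_0[OF dB] cquot_0[OF d] by simp
  then have "exp (2 * (lrad (slitdom A) + lrad (slitdom B))) \<le> exp (3 * lrad ?W)"
    by (simp add: exp_add[symmetric] exp_of_nat_mult[symmetric] flip: exp_add)
  then show ?thesis by simp
qed

section \<open>Poisson kernel barriers for a single slit\<close>

lemma Re_poisson:
  assumes "norm b = 1" "z \<noteq> b"
  shows "Re ((b + z) / (b - z)) = (1 - (norm z)\<^sup>2) / (norm (b - z))\<^sup>2"
proof -
  have "(b + z) / (b - z) = (b + z) * cnj (b - z) / of_real ((norm (b - z))\<^sup>2)"
    using assms(2) by (simp add: complex_norm_square del: of_real_power)
  moreover have "Re ((b + z) * cnj (b - z)) = (norm b)\<^sup>2 - (norm z)\<^sup>2"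
    unfolding cmod_power2 by (simp add: algebra_simps power2_eq_square)
  ultimately show ?thesis using assms(1) by (simp del: of_real_power)
qed

text \<open>Maximum principle: a multiple of the Poisson kernel with pole \<open>b\<close> majorises
  \<open>ln (norm (cquot (slitdom K) z))\<close> once it majorises the boundary values on the slit.
  Near the circle, pole included, positivity of the kernel inside the disk is what bounds the
  quotient.\<close>

lemma cquot_le_exp_poisson:
  assumes K: "is_hull K" and b: "norm b = 1" and a: "0 \<le> a"
    and le: "\<And>w. w \<in> K \<inter> ball 0 1 \<Longrightarrow> - ln (norm w) \<le> a * ((1 - (norm w)\<^sup>2) / (norm (b - w))\<^sup>2)"
    and z: "z \<in> slitdom K"
  shows "norm (cquot (slitdom K) z) \<le> exp (a * ((1 - (norm z)\<^sup>2) / (norm (b - z))\<^sup>2))"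
proof -
  let ?W = "slitdom K"
  note d = adm_slitdom[OF K]
  have W: "open ?W" "0 \<in> ?W" "?W \<subseteq> ball 0 1" using d by (auto simp: adm_def)
  have W': "connected ?W" "bounded ?W"
    using adm_imp_connected[OF d] W(3) bounded_subset[OF bounded_ball] by auto
  \<comment> \<open>The real part of \<open>(b + z) / (b - z)\<close> is the Poisson kernel;
    exponentiating turns the comparison of harmonic functions into a bound on a modulus.\<close>
  define F where "F = (\<lambda>z. cquot ?W z * exp (- (of_real a * ((b + z) / (b - z)))))"
  have zb: "z \<noteq> b" if "norm z < 1" for z using that b by auto
  have hol: "F holomorphic_on ?W"
  proof -
    have "b - z \<noteq> 0" if "z \<in> ?W" for z using zb[of z] that W(3) by auto
    then show ?thesis unfolding F_def using cquot_holomorphic[OF d] by (intro holomorphic_intros)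
  qed
  have nF: "norm (F z) = norm (cquot ?W z) * exp (- (a * ((1 - (norm z)\<^sup>2) / (norm (b - z))\<^sup>2)))"
    if "norm z < 1" for z
  proof -
    have R: "Re (of_real a * c) = a * Re c" for c by simp
    show ?thesis
      unfolding F_def norm_mult norm_exp_eq_Re uminus_complex.sel Re_poisson[OF b zb[OF that], symmetric] R ..
  qed
  have "norm (F z) \<le> 1"
  proof (rule maximum_modulus_limsup[OF W(1) W' hol _ z])
    fix w and e :: real assume w: "w \<in> frontier ?W" and e: "0 < e"
    have evW: "eventually (\<lambda>z. z \<in> ?W) (at w within ?W)" by (auto simp: eventually_at_filter)
    have w0: "w \<noteq> 0" using w W by (auto simp: frontier_def interior_open)
    have ev0: "eventually (\<lambda>z. z \<noteq> 0) (at w within ?W)"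
      using t1_space_nhds[OF w0] by (auto simp: eventually_at_filter elim: eventually_mono)
    consider "norm w = 1" | "w \<in> K \<inter> ball 0 1" using frontier_slitdom[OF K] w by auto
    then show "eventually (\<lambda>z. norm (F z) < 1 + e) (at w within ?W)"
    proof cases
      case 1
      have "((\<lambda>z. 1 / norm z) \<longlongrightarrow> 1 / norm w) (at w within ?W)"
        using 1 by (intro tendsto_intros) auto
      moreover have "eventually (\<lambda>z. norm (F z) \<le> 1 / norm z) (at w within ?W)"
        using evW ev0
      proof eventually_elim
        case (elim z)
        then have z1: "norm z < 1" using W(3) by auto
        have "(norm z)\<^sup>2 \<le> 1" using z1 by (simp add: power_le_one)
        then have "exp (- (a * ((1 - (norm z)\<^sup>2) / (norm (b - z))\<^sup>2))) \<le> 1" using a by simp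
        then have "norm (F z) \<le> norm (cquot ?W z)" unfolding nF[OF z1] by (simp add: mult_left_le)
        also have "\<dots> \<le> 1 / norm z" using cquot_le[OF d] elim by blast
        finally show ?case .
      qed
      ultimately show ?thesis using e 1 by (intro tendsto_upper_bound_eventually) auto
    next
      case 2
      then have wb: "w \<noteq> b" using b by auto
      let ?P = "\<lambda>z. a * ((1 - (norm z)\<^sup>2) / (norm (b - z))\<^sup>2)"
      have "((\<lambda>z. norm (cquot ?W z) * exp (- ?P z)) \<longlongrightarrow> (1 / norm w) * exp (- ?P w)) (at w within ?W)"
        using cquot_frontier[OF d w order_refl] wb by (intro tendsto_intros) auto
      moreover have "(1 / norm w) * exp (- ?P w) \<le> 1"
      proof -
        have "exp (- ?P w) \<le> exp (ln (norm w))" using le[OF 2] by (subst exp_le_cancel_iff) linarith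
        then show ?thesis using w0 by (simp add: divide_le_eq)
      qed
      moreover have "eventually (\<lambda>z. norm (F z) \<le> norm (cquot ?W z) * exp (- ?P z)) (at w within ?W)"
        using evW by eventually_elim (use nF W(3) in force)
      ultimately show ?thesis using e by (intro tendsto_upper_bound_eventually) auto
    qed
  qed
  then have "norm (cquot ?W z) / exp (a * ((1 - (norm z)\<^sup>2) / (norm (b - z))\<^sup>2)) \<le> 1"
    using nF[of z] z W(3) by (auto simp: exp_minus divide_inverse)
  then show ?thesis by (simp add: divide_le_eq)
qed

text \<open>The barrier has its pole at the base point of the slit at angle \<open>\<alpha>\<close>.
  Every point of the other slit is at distance at least \<open>3 * s\<close> from this pole, and
  there the barrier is at most half of \<open>- ln (norm w)\<close>.\<close>

lemma cquot_radial_slit_le: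
  assumes s: "0 < s" "s \<le> 1/2" "4 * s \<le> norm (cis \<alpha> - cis \<beta>)"
    and w: "w \<in> pcurve (\<lambda>_. \<beta>) s \<inter> ball 0 1"
  shows "w \<in> slitdom (pcurve (\<lambda>_. \<alpha>) s) \<and> (norm (cquot (slitdom (pcurve (\<lambda>_. \<alpha>) s)) w))\<^sup>2 \<le> 1 / norm w"
proof -
  let ?K = "pcurve (\<lambda>_. \<alpha>) s"
  have K: "is_hull ?K" using s by (intro is_hull_pcurve) auto
  obtain u where u: "0 \<le> u" "u \<le> s" "w = of_real (1 - u) * cis \<beta>" using w by (auto simp: pcurve_def)
  have nw: "norm w = 1 - u" using u s by (simp add: norm_mult del: of_real_diff)
  have "norm (w - cis \<beta>) = norm (- of_real u * cis \<beta>)" unfolding u(3) by (simp add: algebra_simps)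
  then have "norm (w - cis \<beta>) = u" using u by (simp add: norm_mult)
  then have d: "3 * s \<le> norm (cis \<alpha> - w)"
    using norm_triangle_ineq[of "cis \<alpha> - w" "w - cis \<beta>"] s u by simp
  have "w \<notin> ?K"
  proof
    assume "w \<in> ?K"
    then obtain v where v: "0 \<le> v" "v \<le> s" "w = of_real (1 - v) * cis \<alpha>" by (auto simp: pcurve_def)
    have "norm (cis \<alpha> - w) = norm (of_real v * cis \<alpha>)" unfolding v(3) by (simp add: algebra_simps)
    then show False using d v s by (simp add: norm_mult)
  qed
  then have wW: "w \<in> slitdom ?K" using w s by (subst slitdom_pcurve) auto
  \<comment> \<open>At depth \<open>t\<close> on the slit the Poisson kernel is
    \<open>(2 - t) / t\<close>, while \<open>- ln (1 - t)\<close> is at most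
    \<open>t / (1 - t)\<close>. As \<open>t \<le> s \<le> 1/2\<close>, the factor
    \<open>2 * s\<^sup>2\<close> makes the kernel dominate.\<close>
  let ?a = "2 * s\<^sup>2"
  have "- ln (norm v) \<le> ?a * ((1 - (norm v)\<^sup>2) / (norm (cis \<alpha> - v))\<^sup>2)" if v: "v \<in> ?K \<inter> ball 0 1" for v
  proof -
    obtain t where t: "0 \<le> t" "t \<le> s" "v = of_real (1 - t) * cis \<alpha>" using v by (auto simp: pcurve_def)
    have nv: "norm v = 1 - t" using t s by (simp add: norm_mult del: of_real_diff)
    then have t0: "0 < t" using v by auto
    have "norm (cis \<alpha> - v) = norm (of_real t * cis \<alpha>)" unfolding t(3) by (simp add: algebra_simps)
    then have nb: "norm (cis \<alpha> - v) = t" using t by (simp add: norm_mult)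
    have "- ln (1 - t) = ln (1 / (1 - t))" using t s by (simp add: ln_div)
    also have "\<dots> \<le> 1 / (1 - t) - 1" using t s by (intro ln_le_minus_one) simp
    also have "\<dots> = t / (1 - t)" using t s by (simp add: field_simps)
    also have "\<dots> \<le> ?a * ((1 - (1 - t)\<^sup>2) / t\<^sup>2)"
    proof -
      have "t\<^sup>2 \<le> s\<^sup>2" using t by (intro power_mono) auto
      moreover have "(1/2) * 1 \<le> (1 - t) * (2 - t)" using t s by (intro mult_mono) auto
      ultimately have "t\<^sup>2 * 1 \<le> s\<^sup>2 * (2 * ((1 - t) * (2 - t)))" by (intro mult_mono) auto
      moreover have "?a * ((1 - (1 - t)\<^sup>2) / t\<^sup>2) = 2 * s\<^sup>2 * (2 - t) / t" using t0
        by (simp add: field_simps power2_eq_square)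
      moreover have "t / (1 - t) \<le> X / t" if "t * t \<le> X * (1 - t)" for X
        using that t0 t s by (simp add: divide_simps mult.commute)
      ultimately show ?thesis by (simp add: power2_eq_square ac_simps)
    qed
    finally show ?thesis unfolding nv nb .
  qed
  from cquot_le_exp_poisson[OF K _ _ this wW]
  have "norm (cquot (slitdom ?K) w) \<le> exp (?a * ((1 - (norm w)\<^sup>2) / (norm (cis \<alpha> - w))\<^sup>2))" by simp
  also have "\<dots> \<le> exp (- ln (norm w) / 2)"
  proof -
    have u1: "u < 1" "0 \<le> 1 - (1 - u)\<^sup>2" using u s by (auto simp: power_le_one)
    \<comment> \<open>At distance \<open>3 * s\<close> the barrier is at most 2/9 of
      \<open>1 - (norm w)\<^sup>2\<close>, hence at most one quarter of it, and
      \<open>ln x \<le> x - 1\<close> at the square of the norm turns this into half the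
      logarithm.\<close>
    have "9 * s\<^sup>2 \<le> (norm (cis \<alpha> - w))\<^sup>2" using power_mono[OF d, of 2] s by (simp add: power_mult_distrib)
    moreover have "0 < s\<^sup>2" using s by simp
    ultimately have "?a * ((1 - (1 - u)\<^sup>2) / (norm (cis \<alpha> - w))\<^sup>2) \<le> ?a * ((1 - (1 - u)\<^sup>2) / (9 * s\<^sup>2))"
      using u1 by (intro mult_left_mono divide_left_mono mult_pos_pos) auto
    also have "\<dots> \<le> (1 - (1 - u)\<^sup>2) / 4" using s u1 by (simp add: field_simps)
    also have "\<dots> \<le> - ln (1 - u) / 2"
    proof -
      have "ln ((1 - u)\<^sup>2) \<le> (1 - u)\<^sup>2 - 1" using u1 by (intro ln_le_minus_one) simp
      moreover have "ln ((1 - u)\<^sup>2) = 2 * ln (1 - u)" using u1 by (simp add: ln_realpow)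
      ultimately show ?thesis by simp
    qed
    finally show ?thesis unfolding nw by simp
  qed
  finally have "norm (cquot (slitdom ?K) w) \<le> exp (- ln (norm w) / 2)" .
  then have "(norm (cquot (slitdom ?K) w))\<^sup>2 \<le> (exp (- ln (norm w) / 2))\<^sup>2" by (intro power_mono) auto
  also have "\<dots> = exp (- ln (norm w))" by (simp flip: exp_of_nat_mult)
  also have "\<dots> = 1 / norm w" using nw u s by (simp add: exp_minus inverse_eq_divide)
  finally show ?thesis using wW by blast
qed

text \<open>Mirror slits have equal capacity, so this is the ratio 4/3 between joint and single
  capacity.\<close>

lemma lrad_two_radial_slits:
  assumes "0 < s" "s \<le> 1/2" "4 * s \<le> norm (cis \<alpha> - cis (- \<alpha>))"
  shows "2 * (lrad (slitdom (pcurve (\<lambda>_. \<alpha>) s)) + lrad (slitdom (pcurve (\<lambda>_. - \<alpha>) s)))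
     \<le> 3 * lrad (slitdom (pcurve2 (\<lambda>_. \<alpha>) s))"
  unfolding pcurve2_def
  using assms cquot_radial_slit_le[of s \<alpha> "- \<alpha>"] cquot_radial_slit_le[of s "- \<alpha>" \<alpha>]
  by (intro lrad_Un_ge is_hull_pcurve) (auto simp: norm_minus_commute)

section \<open>Continuity of the capacities\<close>

text \<open>The approximation hypotheses of \<open>lrad_tendsto\<close> as one predicate. Unlike
  convergence of capacities it passes to unions, which is how a pair of curves is handled.\<close>

definition kernel_conv :: "(nat \<Rightarrow> complex set) \<Rightarrow> complex set \<Rightarrow> bool" where
  "kernel_conv Kn K \<longleftrightarrow>
     (\<forall>C. compact C \<longrightarrow> C \<subseteq> ball 0 1 - K \<longrightarrow> eventually (\<lambda>n. C \<inter> Kn n = {}) sequentially) \<and>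
     (\<forall>w\<in>K. \<exists>x. x \<longlonglongrightarrow> w \<and> (\<forall>n. x n \<in> Kn n \<union> - ball 0 1))"

lemma kernel_conv_disjoint:
  "kernel_conv Kn K \<Longrightarrow> compact C \<Longrightarrow> C \<subseteq> ball 0 1 - K \<Longrightarrow> eventually (\<lambda>n. C \<inter> Kn n = {}) sequentially"
  by (simp add: kernel_conv_def)

lemma kernel_conv_approx:
  "kernel_conv Kn K \<Longrightarrow> w \<in> K \<Longrightarrow> \<exists>x. x \<longlonglongrightarrow> w \<and> (\<forall>n. x n \<in> Kn n \<union> - ball 0 1)"
  by (simp add: kernel_conv_def)

lemma kernel_conv_Un:
  assumes "kernel_conv An A" "kernel_conv Bn B"
  shows "kernel_conv (\<lambda>n. An n \<union> Bn n) (A \<union> B)"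
  unfolding kernel_conv_def
proof (intro conjI allI impI ballI)
  fix C assume C: "compact C" "C \<subseteq> ball 0 1 - (A \<union> B)"
  then have "C \<subseteq> ball 0 1 - A" "C \<subseteq> ball 0 1 - B" by auto
  then have "eventually (\<lambda>n. C \<inter> An n = {}) sequentially" "eventually (\<lambda>n. C \<inter> Bn n = {}) sequentially"
    using kernel_conv_disjoint assms C(1) by metis+
  then show "eventually (\<lambda>n. C \<inter> (An n \<union> Bn n) = {}) sequentially" by eventually_elim blast
next
  fix w assume "w \<in> A \<union> B"
  then consider "w \<in> A" | "w \<in> B" by blast
  then show "\<exists>x. x \<longlonglongrightarrow> w \<and> (\<forall>n. x n \<in> An n \<union> Bn n \<union> - ball 0 1)"
    by cases (use kernel_conv_approx[OF assms(1), of w] kernel_conv_approx[OF assms(2), of w] in fast)+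
qed

lemma lrad_tendsto_kernel_conv:
  assumes "is_hull K" "\<And>n::nat. is_hull (Kn n)" "kernel_conv Kn K"
  shows "(\<lambda>n. lrad (slitdom (Kn n))) \<longlonglongrightarrow> lrad (slitdom K)"
  using assms by (intro lrad_tendsto) (auto simp: kernel_conv_def)

text \<open>Convergence of profiles is asked at positive parameters only: points of small depth are
  near the circle, and compact subsets of the open disk do not see them. This admits a limit curve
  whose base point differs from those of the approximating curves. The hypothesis runs along
  subsequences because the proof extracts them.\<close>

lemma kernel_conv_pcurve:
  assumes s: "0 \<le> s" "s < 1" "\<And>n. 0 \<le> sn n" "sn \<longlonglongrightarrow> s"
    and \<phi>: "\<And>u un r. strict_mono r \<Longrightarrow> (\<And>n. 0 \<le> un n \<and> un n \<le> sn (r n)) \<Longrightarrow> un \<longlonglongrightarrow> u \<Longrightarrow> 0 < u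
      \<Longrightarrow> (\<lambda>n. \<phi>n (r n) (un n)) \<longlonglongrightarrow> \<phi> u"
  shows "kernel_conv (\<lambda>n. pcurve (\<phi>n n) (sn n)) (pcurve \<phi> s)"
proof -
  have "eventually (\<lambda>n. C \<inter> pcurve (\<phi>n n) (sn n) = {}) sequentially"
    if C: "compact C" "C \<subseteq> ball 0 1 - pcurve \<phi> s" for C
  proof (rule ccontr)
    assume "\<not> ?thesis"
    then obtain r :: "nat \<Rightarrow> nat" where r: "strict_mono r" "\<And>n. C \<inter> pcurve (\<phi>n (r n)) (sn (r n)) \<noteq> {}"
      using not_eventually_sequentiallyD by blast
    have "\<exists>u. 0 \<le> u \<and> u \<le> sn (r n) \<and> of_real (1 - u) * cis (\<phi>n (r n) u) \<in> C" for n
      using r(2)[of n] unfolding pcurve_def by auto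
    then obtain un where un: "\<And>n. 0 \<le> un n" "\<And>n. un n \<le> sn (r n)"
       "\<And>n. of_real (1 - un n) * cis (\<phi>n (r n) (un n)) \<in> C" by metis
    have "C \<noteq> {}" using un(3) by blast
    then obtain x where x: "x \<in> C" "\<And>y. y \<in> C \<Longrightarrow> norm y \<le> norm x"
      using continuous_attains_sup[OF C(1), of norm] by (auto intro: continuous_intros)
    have x1: "norm x < 1" using x C(2) by auto
    \<comment> \<open>\<open>C\<close> stays off the circle, so these parameters stay away from 0
      and their limit \<open>u\<close> is positive.\<close>
    have ge: "1 - norm x \<le> un n" for n
      using x(2)[OF un(3)[of n]] by (simp add: norm_mult del: of_real_diff)
    have bd: "bounded (range sn)" using s(4) by (rule convergent_imp_bounded)
    then obtain B where "\<And>n. norm (sn n) \<le> B" unfolding bounded_iff by auto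
    then have "un n \<in> {0..B}" for n using un(1,2)[of n] s(3)[of "r n"] 
      by (metis abs_of_nonneg atLeastAtMost_iff order_trans real_norm_def)
    then obtain u q where q: "strict_mono (q :: nat \<Rightarrow> nat)" "(\<lambda>n. un (q n)) \<longlonglongrightarrow> u"
      using compact_Icc[of 0 B] unfolding compact_def comp_def by metis
    have u: "1 - norm x \<le> u" using q(2) ge by (intro LIMSEQ_le_const[OF q(2)]) auto
    have rq: "strict_mono (\<lambda>n. r (q n))" using strict_mono_o[OF r(1) q(1)] by (simp add: comp_def)
    have "(\<lambda>n. sn (r (q n))) \<longlonglongrightarrow> s" using LIMSEQ_subseq_LIMSEQ[OF s(4) rq] by (simp add: comp_def)
    then have us: "u \<le> s" using un(2) by (intro LIMSEQ_le[OF q(2)]) auto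
    have "0 < u" using u x1 by simp
    with rq un(1,2) q(2) have "(\<lambda>n. \<phi>n (r (q n)) (un (q n))) \<longlonglongrightarrow> \<phi> u" by (intro \<phi>) blast+
    then have lim: "(\<lambda>n. of_real (1 - un (q n)) * cis (\<phi>n (r (q n)) (un (q n)))) \<longlonglongrightarrow> of_real (1 - u) * cis (\<phi> u)"
      using q(2) by (intro tendsto_intros isCont_tendsto_compose[of _ cis]) (auto intro: continuous_intros)
    then have "of_real (1 - u) * cis (\<phi> u) \<in> C"
      using un(3) by (intro closed_sequentially[OF compact_imp_closed[OF C(1)] _ lim]) blast
    moreover have "of_real (1 - u) * cis (\<phi> u) \<in> pcurve \<phi> s"
      unfolding pcurve_def using us u x1 by (intro image_eqI[of _ _ u]) auto
    ultimately show False using C(2) by blast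
  qed
  moreover have "\<exists>x. x \<longlonglongrightarrow> w \<and> (\<forall>n. x n \<in> pcurve (\<phi>n n) (sn n) \<union> - ball 0 1)" if w: "w \<in> pcurve \<phi> s" for w
  proof -
    obtain u where "u \<in> {0..s}" and u3: "w = of_real (1 - u) * cis (\<phi> u)"
      using w unfolding pcurve_def by blast
    then have u: "0 \<le> u" "u \<le> s" by auto
    show ?thesis
    proof (cases "u = 0")
      case True
      then show ?thesis using u3 by (intro exI[of _ "\<lambda>_. w"]) auto
    next
      case False
      \<comment> \<open>Cutting off at \<open>sn n\<close> keeps the parameter on the approximating
        curve; it still tends to \<open>u\<close> because \<open>u \<le> s\<close>.\<close>
      define un where "un = (\<lambda>n. min u (sn n))"
      have un: "un \<longlonglongrightarrow> u" using tendsto_min[OF tendsto_const s(4), of u] u(2) by (simp add: un_def min_absorb1)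
      have "(\<lambda>n. \<phi>n (id n) (un n)) \<longlonglongrightarrow> \<phi> u"
        using un u False s by (intro \<phi>) (auto simp: un_def strict_mono_def)
      then have "(\<lambda>n. of_real (1 - un n) * cis (\<phi>n n (un n))) \<longlonglongrightarrow> w"
        using un unfolding u3 by (intro tendsto_intros isCont_tendsto_compose[of _ cis]) (auto intro: continuous_intros)
      moreover have "of_real (1 - un n) * cis (\<phi>n n (un n)) \<in> pcurve (\<phi>n n) (sn n)" for n
        unfolding pcurve_def using u s by (intro imageI) (auto simp: un_def)
      ultimately show ?thesis by blast
    qed
  qed
  ultimately show ?thesis unfolding kernel_conv_def by blast
qed

lemma
  assumes s: "0 \<le> s" "s < 1" "\<And>n. 0 \<le> sn n" "\<And>n. sn n < 1" "sn \<longlonglongrightarrow> s"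
    and c: "continuous_on {0..s} \<phi>" "\<And>n. continuous_on {0..sn n} (\<phi>n n)"
    and \<phi>: "\<And>u un r. strict_mono r \<Longrightarrow> (\<And>n. 0 \<le> un n \<and> un n \<le> sn (r n)) \<Longrightarrow> un \<longlonglongrightarrow> u \<Longrightarrow> 0 < u
      \<Longrightarrow> (\<lambda>n. \<phi>n (r n) (un n)) \<longlonglongrightarrow> \<phi> u"
  shows lrad_pcurve_tendsto:
      "(\<lambda>n. lrad (slitdom (pcurve (\<phi>n n) (sn n)))) \<longlonglongrightarrow> lrad (slitdom (pcurve \<phi> s))"
    and lrad_pcurve2_tendsto:
      "(\<lambda>n. lrad (slitdom (pcurve2 (\<phi>n n) (sn n)))) \<longlonglongrightarrow> lrad (slitdom (pcurve2 \<phi> s))"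
proof -
  have k1: "kernel_conv (\<lambda>n. pcurve (\<phi>n n) (sn n)) (pcurve \<phi> s)"
    by (rule kernel_conv_pcurve[OF s(1,2,3,5)]) (rule \<phi>, assumption+)
  have "kernel_conv (\<lambda>n. pcurve (\<lambda>u. - \<phi>n n u) (sn n)) (pcurve (\<lambda>u. - \<phi> u) s)"
    by (rule kernel_conv_pcurve[OF s(1,2,3,5)]) (rule tendsto_minus, rule \<phi>, assumption+)
  then have k2: "kernel_conv (\<lambda>n. pcurve2 (\<phi>n n) (sn n)) (pcurve2 \<phi> s)"
    unfolding pcurve2_def by (rule kernel_conv_Un[OF k1])
  show "(\<lambda>n. lrad (slitdom (pcurve (\<phi>n n) (sn n)))) \<longlonglongrightarrow> lrad (slitdom (pcurve \<phi> s))"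
    using k1 s c by (intro lrad_tendsto_kernel_conv is_hull_pcurve)
  show "(\<lambda>n. lrad (slitdom (pcurve2 (\<phi>n n) (sn n)))) \<longlonglongrightarrow> lrad (slitdom (pcurve2 \<phi> s))"
    using k2 s c by (intro lrad_tendsto_kernel_conv is_hull_pcurve2)
qed

lemma lrad_pcurve_pos:
  assumes "continuous_on {0..s} \<phi>" "0 < s" "s < 1"
  shows "0 < lrad (slitdom (pcurve \<phi> s))"
proof (rule lrad_pos)
  show "adm (slitdom (pcurve \<phi> s))" using assms by (intro adm_slitdom is_hull_pcurve) auto
  have "of_real (1 - s) * cis (\<phi> s) \<in> pcurve \<phi> s" using assms unfolding pcurve_def by (intro imageI) auto
  moreover have "of_real (1 - s) * cis (\<phi> s) \<in> ball 0 1" using assms by (simp add: norm_mult del: of_real_diff)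
  ultimately show "slitdom (pcurve \<phi> s) \<noteq> ball 0 1" using slitdom_subset[of "pcurve \<phi> s"] by blast
qed

lemma pcurve_uminus: "pcurve (\<lambda>u. - \<phi> u) s = cnj ` pcurve \<phi> s"
  by (auto simp: pcurve_def image_image cis_cnj)

lemma cnj_image_ball_minus: "cnj ` (ball 0 1 - K) = ball 0 1 - cnj ` K"
proof (intro equalityI subsetI)
  fix z assume z: "z \<in> ball 0 1 - cnj ` K"
  then have "cnj z \<notin> K" by (metis Diff_iff complex_cnj_cnj imageI)
  with z show "z \<in> cnj ` (ball 0 1 - K)" by (intro image_eqI[of _ _ "cnj z"]) auto
qed auto

lemma lrad_pcurve_uminus:
  assumes "continuous_on {0..1} \<phi>" "0 \<le> s" "s < 1"
  shows "lrad (slitdom (pcurve (\<lambda>u. - \<phi> u) s)) = lrad (slitdom (pcurve \<phi> s))"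
proof -
  have c: "continuous_on {0..1} (\<lambda>u. - \<phi> u)" using assms by (intro continuous_intros)
  have "slitdom (pcurve (\<lambda>u. - \<phi> u) s) = cnj ` slitdom (pcurve \<phi> s)"
    using slitdom_pcurve[OF assms] slitdom_pcurve[OF c assms(2,3)]
    by (simp add: pcurve_uminus cnj_image_ball_minus)
  moreover have "adm (slitdom (pcurve \<phi> s))" "adm (slitdom (pcurve (\<lambda>u. - \<phi> u) s))"
    using assms c by (auto intro!: adm_slitdom is_hull_pcurve intro: continuous_on_subset)
  ultimately show ?thesis using lrad_cnj by metis
qed

abbreviation cap1 :: "(real \<Rightarrow> real) \<Rightarrow> real \<Rightarrow> real" where
  "cap1 \<phi> s \<equiv> lrad (slitdom (pcurve \<phi> s))"

abbreviation cap2 :: "(real \<Rightarrow> real) \<Rightarrow> real \<Rightarrow> real" where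
  "cap2 \<phi> s \<equiv> lrad (slitdom (pcurve2 \<phi> s))"

text \<open>Convergence in the sup norm implies the convergence along moving parameters that kernel
  convergence asks for. Bounded continuous functions are used because their completeness is what
  Baire's theorem will rest on.\<close>

lemma
  assumes "0 \<le> s" "s < 1"
  shows continuous_cap1: "continuous_on UNIV (\<lambda>\<phi>::real \<Rightarrow>\<^sub>C real. cap1 \<phi> s)"
    and continuous_cap2: "continuous_on UNIV (\<lambda>\<phi>::real \<Rightarrow>\<^sub>C real. cap2 \<phi> s)"
proof -
  have *: "(\<lambda>n. cap1 (\<phi>n n) s) \<longlonglongrightarrow> cap1 \<phi> s \<and> (\<lambda>n. cap2 (\<phi>n n) s) \<longlonglongrightarrow> cap2 \<phi> s"
    if lim: "\<phi>n \<longlonglongrightarrow> \<phi>" for \<phi>n :: "nat \<Rightarrow> real \<Rightarrow>\<^sub>C real" and \<phi>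
  proof -
    have *: "(\<lambda>n. \<phi>n (r n) (un n)) \<longlonglongrightarrow> \<phi> u" if r: "strict_mono r" and un: "un \<longlonglongrightarrow> u" for u un r
    proof -
      have "(\<lambda>n. dist (\<phi>n (r n)) \<phi>) \<longlonglongrightarrow> 0"
        using LIMSEQ_subseq_LIMSEQ[OF lim r] unfolding comp_def by (rule tendsto_dist_iff[THEN iffD1])
      moreover have "\<forall>\<^sub>F n in sequentially. norm (\<phi>n (r n) (un n) - \<phi> (un n)) \<le> dist (\<phi>n (r n)) \<phi>"
        by (intro always_eventually allI) (metis dist_bounded dist_norm)
      ultimately have "(\<lambda>n. \<phi>n (r n) (un n) - \<phi> (un n)) \<longlonglongrightarrow> 0"
        by (rule Lim_null_comparison[rotated])
      moreover have "(\<lambda>n. \<phi> (un n)) \<longlonglongrightarrow> \<phi> u"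
        using un by (intro continuous_on_tendsto_compose[of UNIV \<phi>]) auto
      ultimately have "(\<lambda>n. (\<phi>n (r n) (un n) - \<phi> (un n)) + \<phi> (un n)) \<longlonglongrightarrow> 0 + \<phi> u" by (rule tendsto_add)
      then show ?thesis by simp
    qed
    have "(\<lambda>n. cap1 (\<phi>n n) s) \<longlonglongrightarrow> cap1 \<phi> s"
      by (rule lrad_pcurve_tendsto[where \<phi>n = "\<lambda>n. apply_bcontfun (\<phi>n n)" and sn = "\<lambda>_. s"])
         (use assms * in auto)
    moreover have "(\<lambda>n. cap2 (\<phi>n n) s) \<longlonglongrightarrow> cap2 \<phi> s"
      by (rule lrad_pcurve2_tendsto[where \<phi>n = "\<lambda>n. apply_bcontfun (\<phi>n n)" and sn = "\<lambda>_. s"])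
         (use assms * in auto)
    ultimately show ?thesis ..
  qed
  show "continuous_on UNIV (\<lambda>\<phi>::real \<Rightarrow>\<^sub>C real. cap1 \<phi> s)" "continuous_on UNIV (\<lambda>\<phi>::real \<Rightarrow>\<^sub>C real. cap2 \<phi> s)"
    unfolding continuous_on_eq_continuous_at[OF open_UNIV] continuous_at_sequentially comp_def
    using * by blast+
qed

section \<open>Generic profiles\<close>

text \<open>Only weak inequalities, so that the set is closed in a complete space; strict positivity
  returns as the generic condition \<open>pos_from\<close>. The bound 1 lies below pi, hence a
  positive angle and its negative give different points.\<close>

definition profiles :: "(real \<Rightarrow>\<^sub>C real) set" where
  "profiles = {\<phi> :: real \<Rightarrow>\<^sub>C real. \<phi> 0 = 0 \<and> (\<forall>u. 0 \<le> \<phi> u \<and> \<phi> u \<le> 1)}"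

lemma closed_profiles: "closed profiles"
proof -
  have "profiles = PiC UNIV (\<lambda>u. if u = 0 then {0} else {0..1})"
    by (auto simp: profiles_def mem_PiC_iff Pi_iff split: if_splits) (metis order_refl zero_le_one)+
  moreover have "closed (PiC UNIV (\<lambda>u::real. if u = 0 then {0::real} else {0..1}))"
    by (intro closed_PiC) auto
  ultimately show ?thesis by simp
qed

lemma ex_near_profile:
  fixes \<phi> :: "real \<Rightarrow>\<^sub>C real"
  assumes "continuous_on UNIV f" "f 0 = 0" "\<And>u. 0 \<le> f u \<and> f u \<le> 1" "\<And>u. \<bar>\<phi> u - f u\<bar> \<le> e"
  obtains \<psi> :: "real \<Rightarrow>\<^sub>C real" where "\<psi> \<in> profiles" "apply_bcontfun \<psi> = f" "dist \<phi> \<psi> \<le> e"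
proof
  have f: "f \<in> bcontfun" using assms(1,3) by (intro bcontfun_normI[of f 1]) (auto simp: abs_le_iff)
  then show 1: "apply_bcontfun (Bcontfun f) = f" by (simp add: Bcontfun_inverse)
  show "Bcontfun f \<in> profiles" unfolding profiles_def using assms 1 by simp
  show "dist \<phi> (Bcontfun f) \<le> e" using assms(4) 1 by (intro dist_bound) (simp add: dist_real_def)
qed

lemma profile_small_near_0:
  assumes "\<phi> \<in> profiles" "0 < e"
  shows "\<exists>d>0. \<forall>u. 0 \<le> u \<longrightarrow> u \<le> d \<longrightarrow> \<phi> u < e"
proof -
  have "continuous_on UNIV \<phi>" by simp
  then obtain d where d: "0 < d" "\<And>u. dist u 0 < d \<Longrightarrow> dist (\<phi> u) (\<phi> 0) < e"
    using assms(2) unfolding continuous_on_iff by (metis UNIV_I)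
  have "\<phi> u < e" if "0 \<le> u" "u \<le> d / 2" for u
    using d(1) d(2)[of u] that assms(1) by (simp add: profiles_def)
  then show ?thesis using d(1) by (intro exI[of _ "d / 2"]) auto
qed

section \<open>The three generic conditions: openness and density\<close>

definition ratio_low :: "real \<Rightarrow> (real \<Rightarrow>\<^sub>C real) set" where
  "ratio_low d = (\<Union>s\<in>{0<..<d} \<inter> {..1/2}. {\<phi> :: real \<Rightarrow>\<^sub>C real. cap2 \<phi> s < (1 + d) * cap1 \<phi> s})"

definition ratio_high :: "real \<Rightarrow> (real \<Rightarrow>\<^sub>C real) set" where
  "ratio_high d = (\<Union>s\<in>{0<..<d} \<inter> {..1/2}. {\<phi> :: real \<Rightarrow>\<^sub>C real. 5/4 * cap1 \<phi> s < cap2 \<phi> s})"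

text \<open>A positive continuous function has a positive minimum on a compact interval, hence
  openness. Positivity on \<open>{0<..1}\<close> is not open itself, but it is a countable
  intersection of such sets.\<close>

definition pos_from :: "real \<Rightarrow> (real \<Rightarrow>\<^sub>C real) set" where
  "pos_from d = {\<phi> :: real \<Rightarrow>\<^sub>C real. \<forall>u\<in>{d..1}. 0 < \<phi> u}"

lemma open_ratio_low: "open (ratio_low d)"
  unfolding ratio_low_def
  by (intro open_UN ballI open_Collect_less continuous_intros continuous_cap1 continuous_cap2) auto

lemma open_ratio_high: "open (ratio_high d)"
  unfolding ratio_high_def
  by (intro open_UN ballI open_Collect_less continuous_intros continuous_cap1 continuous_cap2) auto

lemma open_pos_from: "open (pos_from d)"
  unfolding open_dist
proof (intro ballI)
  fix \<phi> assume \<phi>: "\<phi> \<in> pos_from d"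
  show "\<exists>e>0. \<forall>\<psi>. dist \<psi> \<phi> < e \<longrightarrow> \<psi> \<in> pos_from d"
  proof (cases "d \<le> 1")
    case True
    obtain v where v: "v \<in> {d..1}" "\<And>u. u \<in> {d..1} \<Longrightarrow> \<phi> v \<le> \<phi> u"
      using continuous_attains_inf[of "{d..1}" "apply_bcontfun \<phi>"] True by auto
    have "\<psi> \<in> pos_from d" if "dist \<psi> \<phi> < \<phi> v" for \<psi>
      unfolding pos_from_def
    proof (intro CollectI ballI)
      fix u assume "u \<in> {d..1}"
      then have "\<phi> v \<le> \<phi> u" by (rule v(2))
      moreover have "\<bar>\<psi> u - \<phi> u\<bar> < \<phi> v" using that dist_bounded[of \<psi> u \<phi>] by (simp add: dist_real_def)
      ultimately show "0 < \<psi> u" by linarith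
    qed
    moreover have "0 < \<phi> v" using \<phi> v(1) by (auto simp: pos_from_def)
    ultimately show ?thesis by blast
  qed (auto simp: pos_from_def intro: exI[of _ 1])
qed

text \<open>A small multiple of \<open>min 1 \<bar>u\<bar>\<close> is added: it vanishes at 0, which
  keeps the base point, and truncation at 1 keeps the profile admissible.\<close>

lemma dense_pos_from:
  assumes \<phi>: "\<phi> \<in> profiles" and e: "0 < e" and d: "0 < d"
  obtains \<psi> where "\<psi> \<in> profiles" "\<psi> \<in> pos_from d" "dist \<phi> \<psi> \<le> e"
proof -
  have \<phi>': "\<phi> 0 = 0" "\<And>u. 0 \<le> \<phi> u" "\<And>u. \<phi> u \<le> 1" using \<phi> by (auto simp: profiles_def)
  define f where "f = (\<lambda>u. min 1 (\<phi> u + e * min 1 \<bar>u\<bar>))"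
  have "\<bar>\<phi> u - f u\<bar> \<le> e" for u
  proof -
    have "0 \<le> e * min 1 \<bar>u\<bar>" "e * min 1 \<bar>u\<bar> \<le> e * 1" using e by (auto intro!: mult_left_mono mult_nonneg_nonneg)
    then show ?thesis using \<phi>'(3)[of u] unfolding f_def by linarith
  qed
  moreover have "continuous_on UNIV f" unfolding f_def by (intro continuous_intros) auto
  moreover have "f 0 = 0" using \<phi>' by (simp add: f_def)
  moreover have "0 \<le> f u \<and> f u \<le> 1" for u using \<phi>'(2)[of u] e by (auto simp: f_def)
  ultimately obtain \<psi> :: "real \<Rightarrow>\<^sub>C real" where \<psi>: "\<psi> \<in> profiles" "apply_bcontfun \<psi> = f" "dist \<phi> \<psi> \<le> e"
    using ex_near_profile[of f \<phi> e] by metis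
  have "0 < f u" if "u \<in> {d..1}" for u
    using that d e \<phi>'(2)[of u] by (auto simp: f_def intro!: add_nonneg_pos mult_pos_pos)
  then have "\<psi> \<in> pos_from d" by (simp add: pos_from_def \<psi>(2))
  with \<psi> show thesis using that by blast
qed

text \<open>Flattening the profile near \<open>0\<close> makes both curves start with the same radial slit.\<close>
lemma dense_ratio_low:
  assumes \<phi>: "\<phi> \<in> profiles" and e: "0 < e" and d: "0 < d"
  obtains \<psi> where "\<psi> \<in> profiles" "\<psi> \<in> ratio_low d" "dist \<phi> \<psi> \<le> e"
proof -
  have \<phi>': "\<phi> 0 = 0" "\<And>u. 0 \<le> \<phi> u" "\<And>u. \<phi> u \<le> 1" using \<phi> by (auto simp: profiles_def)
  define f where "f = (\<lambda>u. max 0 (\<phi> u - e))"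
  have "\<bar>\<phi> u - f u\<bar> \<le> e" for u
    using \<phi>'(2)[of u] e by (simp add: f_def)
  moreover have "continuous_on UNIV f" unfolding f_def by (intro continuous_intros) auto
  moreover have "f 0 = 0" using \<phi>' e by (simp add: f_def)
  moreover have "0 \<le> f u \<and> f u \<le> 1" for u using \<phi>'(3)[of u] e by (auto simp: f_def)
  ultimately obtain \<psi> :: "real \<Rightarrow>\<^sub>C real" where \<psi>: "\<psi> \<in> profiles" "apply_bcontfun \<psi> = f" "dist \<phi> \<psi> \<le> e"
    using ex_near_profile[of f \<phi> e] by metis
  obtain c where c: "0 < c" "\<And>u. 0 \<le> u \<Longrightarrow> u \<le> c \<Longrightarrow> \<phi> u < e" 
    using profile_small_near_0[OF \<phi> e] by blast
  define s where "s = min c (min (d/2) (1/2))"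
  have s: "0 < s" "s < d" "s \<le> 1/2" "s \<le> c" using c d by (auto simp: s_def)
  have "f u = 0" if "0 \<le> u" "u \<le> s" for u using c(2)[of u] that s by (simp add: f_def)
  then have "pcurve (\<lambda>u. - f u) s = pcurve f s" by (auto simp: pcurve_def intro!: image_cong)
  then have "cap2 f s = cap1 f s" by (simp add: pcurve2_def)
  moreover have "0 < cap1 f s"
    using s by (intro lrad_pcurve_pos) (auto simp: f_def intro!: continuous_intros)
  ultimately have "cap2 f s < (1 + d) * cap1 f s" using d by simp
  then have "\<psi> \<in> ratio_low d" using s unfolding ratio_low_def by (auto simp: \<psi>(2))
  with \<psi> show thesis using that by blast
qed

text \<open>Moving quickly to the angle \<open>e\<close> along the circle and then radially inwards approximates two
  separate radial slits.\<close>
lemma dense_ratio_high: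
  assumes \<phi>: "\<phi> \<in> profiles" and e: "0 < e" "e \<le> 1" and d: "0 < d"
  obtains \<psi> where "\<psi> \<in> profiles" "\<psi> \<in> ratio_high d" "dist \<phi> \<psi> \<le> e"
proof -
  have \<phi>': "\<phi> 0 = 0" "\<And>u. 0 \<le> \<phi> u" "\<And>u. \<phi> u \<le> 1" using \<phi> by (auto simp: profiles_def)
  obtain c where c: "0 < c" "\<And>u. 0 \<le> u \<Longrightarrow> u \<le> c \<Longrightarrow> \<phi> u < e" 
    using profile_small_near_0[OF \<phi> e(1)] by blast
  have "0 < sin e" using e pi_gt3 by (intro sin_gt_zero) auto
  then have sep: "0 < norm (cis e - cis (- e))" by (auto simp: complex_eq_iff)
  \<comment> \<open>\<open>s \<le> c\<close> keeps \<open>\<phi>\<close> below \<open>e\<close> down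
    to depth \<open>s\<close>, so that the new profile can be constantly \<open>e\<close> there; the
    last bound is the separation asked by \<open>lrad_two_radial_slits\<close>.\<close>
  define s where "s = min c (min (d/2) (min (1/2) (norm (cis e - cis (- e)) / 4)))"
  have s: "0 < s" "s < d" "s \<le> 1/2" "s \<le> c" "4 * s \<le> norm (cis e - cis (- e))"
    using c d sep by (auto simp: s_def)
  define \<eta> where "\<eta> = (\<lambda>n. s / real (Suc n))"
  have \<eta>: "0 < \<eta> n" for n using s by (simp add: \<eta>_def)
  have \<eta>0: "\<eta> \<longlonglongrightarrow> 0" unfolding \<eta>_def by (rule LIMSEQ_Suc[OF lim_const_over_n])
  \<comment> \<open>The ramp climbs from 0 to \<open>e\<close> within depth \<open>\<eta> n\<close>.
    Taking the maximum moves the profile by at most \<open>e\<close> and fixes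
    \<open>f n 0 = 0\<close>, although the limit profile is constantly \<open>e\<close>; the two
    differ only at depths tending to 0.\<close>
  define f where "f = (\<lambda>n u. max (\<phi> u) (min e (u * e / \<eta> n)))"
  have contf: "continuous_on A (f n)" for n A unfolding f_def using \<eta>[of n] by (intro continuous_intros) auto
  have lim: "(\<lambda>n. f (r n) (un n)) \<longlonglongrightarrow> e"
    if r: "strict_mono r" and un: "\<And>n. 0 \<le> un n \<and> un n \<le> s" "un \<longlonglongrightarrow> u" "0 < u" for u un r
  proof (rule tendsto_eventually)
    have "(\<lambda>n. \<eta> (r n)) \<longlonglongrightarrow> 0" using LIMSEQ_subseq_LIMSEQ[OF \<eta>0 r] by (simp add: comp_def)
    then have "eventually (\<lambda>n. \<eta> (r n) < u / 2) sequentially" using un(3) by (intro order_tendstoD(2)) auto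
    moreover have "eventually (\<lambda>n. u / 2 < un n) sequentially" using un(2,3) by (intro order_tendstoD(1)) auto
    ultimately show "eventually (\<lambda>n. f (r n) (un n) = e) sequentially"
    proof eventually_elim
      case (elim n)
      then have "1 * e \<le> un n / \<eta> (r n) * e" using e \<eta>[of "r n"] by (intro mult_right_mono) auto
      moreover have "\<phi> (un n) < e" using c(2)[of "un n"] un(1)[of n] s by simp
      ultimately show ?case by (simp add: f_def)
    qed
  qed
  let ?g = "\<lambda>_::real. e"
  have c1: "(\<lambda>n. cap1 (f n) s) \<longlonglongrightarrow> cap1 ?g s"
    by (rule lrad_pcurve_tendsto[where \<phi>n = f and sn = "\<lambda>_. s"]) (use s contf lim in auto)
  have c2: "(\<lambda>n. cap2 (f n) s) \<longlonglongrightarrow> cap2 ?g s"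
    by (rule lrad_pcurve2_tendsto[where \<phi>n = f and sn = "\<lambda>_. s"]) (use s contf lim in auto)
  have pos: "0 < cap1 ?g s" using s by (intro lrad_pcurve_pos) auto
  have "cap1 (\<lambda>u. - e) s = cap1 ?g s" using s by (intro lrad_pcurve_uminus) auto
  then have "4 * cap1 ?g s \<le> 3 * cap2 ?g s" using lrad_two_radial_slits[of s e] s by simp
  \<comment> \<open>The gap between 4/3 and 5/4 absorbs the passage from the limit profile back to
    some \<open>f n\<close>.\<close>
  then have "5/4 * cap1 ?g s < cap2 ?g s" using pos by linarith
  moreover have "(\<lambda>n. cap2 (f n) s - 5/4 * cap1 (f n) s) \<longlonglongrightarrow> cap2 ?g s - 5/4 * cap1 ?g s"
    by (intro tendsto_intros c1 c2)
  ultimately have "eventually (\<lambda>n. 0 < cap2 (f n) s - 5/4 * cap1 (f n) s) sequentially"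
    by (intro order_tendstoD(1)) auto
  then obtain n where n: "5/4 * cap1 (f n) s < cap2 (f n) s"
    using eventually_happens' sequentially_bot by fastforce
  have "\<bar>\<phi> u - f n u\<bar> \<le> e" for u using \<phi>'(2)[of u] e by (simp add: f_def)
  moreover have "f n 0 = 0" using \<phi>' e by (simp add: f_def)
  moreover have "0 \<le> f n u \<and> f n u \<le> 1" for u using \<phi>'(2,3)[of u] e by (auto simp: f_def)
  ultimately obtain \<psi> :: "real \<Rightarrow>\<^sub>C real" where \<psi>: "\<psi> \<in> profiles" "apply_bcontfun \<psi> = f n" "dist \<phi> \<psi> \<le> e"
    using ex_near_profile[of "f n" \<phi> e] contf by metis
  have "\<psi> \<in> ratio_high d" using s n unfolding ratio_high_def by (auto simp: \<psi>(2))
  with \<psi> show thesis using that by blast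
qed

lemma closure_of_profiles:
  assumes "\<And>\<phi> e. \<phi> \<in> profiles \<Longrightarrow> 0 < e \<Longrightarrow> e \<le> 1 \<Longrightarrow> \<exists>\<psi>\<in>profiles \<inter> T. dist \<phi> \<psi> \<le> e"
  shows "top_of_set profiles closure_of (profiles \<inter> T) = profiles"
proof -
  have "profiles \<subseteq> closure (profiles \<inter> T)"
  proof
    fix \<phi> assume \<phi>: "\<phi> \<in> profiles"
    show "\<phi> \<in> closure (profiles \<inter> T)"
      unfolding closure_approachable
    proof (intro allI impI)
      fix e :: real assume e: "0 < e"
      then obtain \<psi> where "\<psi> \<in> profiles \<inter> T" "dist \<phi> \<psi> \<le> min 1 (e / 2)"
        using assms[OF \<phi>, of "min 1 (e / 2)"] by auto
      then show "\<exists>\<psi>\<in>profiles \<inter> T. dist \<psi> \<phi> < e" using e by (auto simp: dist_commute intro!: bexI[of _ \<psi>])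
    qed
  qed
  then show ?thesis by (auto simp: closure_of_subtopology Int_absorb1 inf.absorb1)
qed

text \<open>Baire's theorem in the closed set \<open>profiles\<close>. The countably many scales
  \<open>1 / (n + 1)\<close> suffice because each condition at a smaller scale implies the same
  condition at a larger one.\<close>

lemma ex_oscillating_profile:
  obtains \<phi> :: "real \<Rightarrow> real" where "continuous_on UNIV \<phi>" "\<phi> 0 = 0" "\<And>u. 0 < u \<Longrightarrow> u \<le> 1 \<Longrightarrow> 0 < \<phi> u \<and> \<phi> u \<le> 1"
    "\<And>d. 0 < d \<Longrightarrow> \<exists>s. 0 < s \<and> s < d \<and> s \<le> 1/2 \<and> cap2 \<phi> s < (1 + d) * cap1 \<phi> s"
    "\<And>d. 0 < d \<Longrightarrow> \<exists>s. 0 < s \<and> s < d \<and> s \<le> 1/2 \<and> 5/4 * cap1 \<phi> s < cap2 \<phi> s"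
proof -
  let ?d = "\<lambda>n. 1 / real (Suc n)"
  let ?X = "top_of_set profiles"
  have dpos: "0 < ?d n" for n by simp
  define \<G> where "\<G> = range (\<lambda>n. profiles \<inter> ratio_low (?d n)) \<union> range (\<lambda>n. profiles \<inter> ratio_high (?d n))
     \<union> range (\<lambda>n. profiles \<inter> pos_from (?d n))"
  have generic: "openin ?X (profiles \<inter> T) \<and> ?X closure_of (profiles \<inter> T) = topspace ?X"
    if "open T" "\<And>\<phi> e. \<phi> \<in> profiles \<Longrightarrow> 0 < e \<Longrightarrow> e \<le> 1 \<Longrightarrow> \<exists>\<psi>\<in>profiles \<inter> T. dist \<phi> \<psi> \<le> e" for T
    using closure_of_profiles[OF that(2)] openin_open_Int[OF that(1), of profiles] by simp
  have "?X closure_of \<Inter>\<G> = topspace ?X"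
  proof (rule Baire_category)
    have "closedin euclidean profiles" using closed_profiles by (simp only: closed_closedin)
    then show "completely_metrizable_space ?X \<or> locally_compact_space ?X \<and> regular_space ?X"
      using completely_metrizable_space_closedin[OF completely_metrizable_space_euclidean] by blast
    show "countable \<G>" unfolding \<G>_def by (intro countable_Un countable_image) auto
  next
    fix T assume "T \<in> \<G>"
    then obtain n where "T = profiles \<inter> ratio_low (?d n) \<or> T = profiles \<inter> ratio_high (?d n) \<or>
       T = profiles \<inter> pos_from (?d n)"
      unfolding \<G>_def Un_iff image_iff by fast
    then show "openin ?X T \<and> ?X closure_of T = topspace ?X"
    proof (elim disjE)
      assume T: "T = profiles \<inter> ratio_low (?d n)"
      show ?thesis unfolding T
      proof (rule generic[OF open_ratio_low])
        fix \<phi> :: "real \<Rightarrow>\<^sub>C real" and e :: real assume "\<phi> \<in> profiles" "0 < e" "e \<le> 1"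
        then show "\<exists>\<psi>\<in>profiles \<inter> ratio_low (?d n). dist \<phi> \<psi> \<le> e"
          by (rule_tac dense_ratio_low[OF _ _ dpos[of n]]) blast+
      qed
    next
      assume T: "T = profiles \<inter> ratio_high (?d n)"
      show ?thesis unfolding T
      proof (rule generic[OF open_ratio_high])
        fix \<phi> :: "real \<Rightarrow>\<^sub>C real" and e :: real assume "\<phi> \<in> profiles" "0 < e" "e \<le> 1"
        then show "\<exists>\<psi>\<in>profiles \<inter> ratio_high (?d n). dist \<phi> \<psi> \<le> e"
          by (rule_tac dense_ratio_high[OF _ _ _ dpos[of n]]) blast+
      qed
    next
      assume T: "T = profiles \<inter> pos_from (?d n)"
      show ?thesis unfolding T
      proof (rule generic[OF open_pos_from])
        fix \<phi> :: "real \<Rightarrow>\<^sub>C real" and e :: real assume "\<phi> \<in> profiles" "0 < e" "e \<le> 1"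
        then show "\<exists>\<psi>\<in>profiles \<inter> pos_from (?d n). dist \<phi> \<psi> \<le> e"
          by (rule_tac dense_pos_from[OF _ _ dpos[of n]]) blast+
      qed
    qed
  qed
  moreover have "0 \<in> profiles" by (simp add: profiles_def)
  ultimately have "\<Inter>\<G> \<noteq> {}" by auto
  then obtain \<phi> where \<phi>: "\<phi> \<in> \<Inter>\<G>" by blast
  have "profiles \<inter> ratio_low (?d n) \<in> \<G>" "profiles \<inter> ratio_high (?d n) \<in> \<G>" "profiles \<inter> pos_from (?d n) \<in> \<G>"
    for n unfolding \<G>_def by (simp_all add: image_iff) metis+
  with \<phi> have mem: "\<phi> \<in> profiles" "\<And>n. \<phi> \<in> ratio_low (?d n)" "\<And>n. \<phi> \<in> ratio_high (?d n)" "\<And>n. \<phi> \<in> pos_from (?d n)"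
    by (meson InterD IntD1 IntD2)+
  have ex: "\<exists>n. ?d n < d" if "0 < d" for d :: real using reals_Archimedean[OF that] by (simp add: inverse_eq_divide)
  show thesis
  proof (rule that[of \<phi>])
    show "continuous_on UNIV \<phi>" "\<phi> 0 = 0" using mem(1) by (auto simp: profiles_def)
    show "0 < \<phi> u \<and> \<phi> u \<le> 1" if "0 < u" "u \<le> 1" for u
    proof -
      obtain n where "?d n < u" using ex[OF \<open>0 < u\<close>] by blast
      then show ?thesis using mem(1) mem(4)[of n] that by (auto simp: profiles_def pos_from_def)
    qed
    fix d :: real assume "0 < d"
    then obtain n where n: "?d n < d" using ex by blast
    obtain s where s: "0 < s" "s < ?d n" "s \<le> 1/2" "cap2 \<phi> s < (1 + ?d n) * cap1 \<phi> s"
      using mem(2)[of n] unfolding ratio_low_def by auto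
    have "0 < cap1 \<phi> s" using s by (intro lrad_pcurve_pos) auto
    then have "(1 + ?d n) * cap1 \<phi> s \<le> (1 + d) * cap1 \<phi> s" using n by (intro mult_right_mono) auto
    then have "cap2 \<phi> s < (1 + d) * cap1 \<phi> s" using s(4) by linarith
    then show "\<exists>s. 0 < s \<and> s < d \<and> s \<le> 1/2 \<and> cap2 \<phi> s < (1 + d) * cap1 \<phi> s"
      using s n by (intro exI[of _ s]) auto
    obtain s where "0 < s" "s < ?d n" "s \<le> 1/2" "5/4 * cap1 \<phi> s < cap2 \<phi> s"
      using mem(3)[of n] unfolding ratio_high_def by auto
    then show "\<exists>s. 0 < s \<and> s < d \<and> s \<le> 1/2 \<and> 5/4 * cap1 \<phi> s < cap2 \<phi> s"
      using n by (intro exI[of _ s]) auto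
  qed
qed

section \<open>Consequence of differentiability\<close>

text \<open>The Moebius map \<open>(f - d) / (f + d)\<close> takes the right half plane into the
  unit disk. The Schwarz lemma on half the radius bounds it by 1/2, and
  \<open>(1 + 1/2) / (1 - 1/2) = 3\<close>.\<close>

lemma norm_le_3_of_Re_pos:
  assumes f: "f holomorphic_on ball 0 r" "\<And>z. z \<in> ball 0 r \<Longrightarrow> 0 < Re (f z)" "f 0 = of_real d"
    and z: "norm z \<le> r / 2" and r: "0 < r"
  shows "norm (f z) \<le> 3 * d"
proof -
  have d: "0 < d" using f(2)[of 0] f(3) r by simp
  have nz: "f w + of_real d \<noteq> 0" if "w \<in> ball 0 r" for w
    using f(2)[OF that] d by (auto simp: complex_eq_iff)
  have lt: "norm (f w - of_real d) < norm (f w + of_real d)" if "w \<in> ball 0 r" for w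
  proof -
    have "(norm (f w + of_real d))\<^sup>2 - (norm (f w - of_real d))\<^sup>2 = 4 * d * Re (f w)"
      unfolding cmod_power2 by (simp add: power2_eq_square algebra_simps)
    moreover have "0 < 4 * d * Re (f w)" using f(2)[OF that] d by simp
    ultimately have "(norm (f w - of_real d))\<^sup>2 < (norm (f w + of_real d))\<^sup>2" by linarith
    then show ?thesis by (rule power2_less_imp_less) simp
  qed
  define m where "m = (\<lambda>\<zeta>. (f (of_real r * \<zeta>) - of_real d) / (f (of_real r * \<zeta>) + of_real d))"
  have in_ball: "of_real r * \<zeta> \<in> ball 0 r" if "norm \<zeta> < 1" for \<zeta> :: complex
    using that r by (simp add: norm_mult)
  have "(\<lambda>\<zeta>. f (of_real r * \<zeta>)) holomorphic_on ball 0 1"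
    using in_ball by (intro holomorphic_on_compose_gen[of "\<lambda>\<zeta>. of_real r * \<zeta>" "ball 0 1" f "ball 0 r", unfolded comp_def] f(1))
      (auto intro!: holomorphic_intros)
  then have "m holomorphic_on ball 0 1"
    unfolding m_def using nz in_ball by (intro holomorphic_intros) auto
  moreover have "m 0 = 0" using f(3) by (simp add: m_def)
  moreover have "norm (m \<zeta>) < 1" if "norm \<zeta> < 1" for \<zeta>
    using lt[OF in_ball[OF that]] by (simp add: m_def norm_divide divide_less_eq)
  moreover have "norm (z / of_real r) < 1" using z r by (simp add: norm_divide divide_less_eq)
  ultimately have "norm (m (z / of_real r)) \<le> norm (z / of_real r)" by (rule Schwarz_Lemma(1))
  also have "\<dots> \<le> 1 / 2" using z r by (simp add: norm_divide field_simps)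
  finally have "norm ((f z - of_real d) / (f z + of_real d)) \<le> 1 / 2" using r by (simp add: m_def)
  moreover have "z \<in> ball 0 r" using z r by simp
  ultimately have "2 * norm (f z - of_real d) \<le> norm (f z + of_real d)"
    using nz[of z] by (simp add: norm_divide divide_le_eq)
  moreover have "norm (f z) - d \<le> norm (f z - of_real d)" "norm (f z + of_real d) \<le> norm (f z) + d"
    using norm_triangle_ineq2[of "f z" "of_real d"] norm_triangle_ineq[of "f z" "of_real d"] d by simp_all
  ultimately show ?thesis by linarith
qed

text \<open>A small positive constant added to \<open>f\<close> pushes the closed half plane into
  the open one.\<close>

lemma norm_le_3_of_Re_nonneg:
  assumes f: "f holomorphic_on ball 0 r" "\<And>z. z \<in> ball 0 r \<Longrightarrow> 0 \<le> Re (f z)" "f 0 = of_real d"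
    and z: "norm z \<le> r / 2" and r: "0 < r"
  shows "norm (f z) \<le> 3 * d"
proof (rule field_le_epsilon)
  fix e :: real assume "0 < e"
  define \<epsilon> where "\<epsilon> = e / 4"
  have \<epsilon>: "0 < \<epsilon>" using \<open>0 < e\<close> by (simp add: \<epsilon>_def)
  have "norm (f z + of_real \<epsilon>) \<le> 3 * (d + \<epsilon>)"
    by (rule norm_le_3_of_Re_pos[OF _ _ _ z r]) (use f \<epsilon> in \<open>auto intro!: holomorphic_intros add_nonneg_pos\<close>)
  moreover have "norm (f z) \<le> norm (f z + of_real \<epsilon>) + \<epsilon>"
    using norm_triangle_ineq[of "f z + of_real \<epsilon>" "- of_real \<epsilon>"] \<epsilon> by simp
  ultimately show "norm (f z) \<le> 3 * d + e" by (simp add: \<epsilon>_def)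
qed

text \<open>\<open>1 - 1 / cquot W\<close> has nonnegative real part because the quotient has
  modulus at least 1, and at 0 it is at most the capacity; the half plane bound spreads this to the
  smaller disk. The displacement is this function times the map, whose modulus is below 1.\<close>

lemma norm_conf_map_near_id:
  assumes W: "adm W" "ball 0 r \<subseteq> W" and z: "norm z \<le> r / 2" and r: "0 < r"
  shows "norm (norm_conf_map W z - z) \<le> 3 * lrad W"
proof -
  let ?q = "cquot W" and ?g = "norm_conf_map W"
  have zW: "z \<in> W" using W(2) z r by auto
  have q1: "1 \<le> norm (?q w)" if "w \<in> ball 0 r" for w using cquot_ge_1[OF W(1)] that W(2) by blast
  define f where "f = (\<lambda>z. 1 - 1 / ?q z)"
  have "?q 0 = of_real (exp (lrad W))" unfolding cquot_def exp_lrad(2)[OF W(1)] by simp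
  then have f0: "f 0 = of_real (1 - exp (- lrad W))" by (simp add: f_def exp_minus inverse_eq_divide)
  have "?q w \<noteq> 0" if "w \<in> ball 0 r" for w using q1[OF that] by auto
  then have hol: "f holomorphic_on ball 0 r"
    unfolding f_def using holomorphic_on_subset[OF cquot_holomorphic[OF W(1)] W(2)]
    by (intro holomorphic_intros) auto
  have re: "0 \<le> Re (f w)" if "w \<in> ball 0 r" for w
  proof -
    have "norm (1 / ?q w) \<le> 1" using q1[OF that] by (simp add: norm_divide divide_le_eq)
    then show ?thesis using complex_Re_le_cmod[of "1 / ?q w"] unfolding f_def by simp
  qed
  have "norm (f z) \<le> 3 * (1 - exp (- lrad W))" by (rule norm_le_3_of_Re_nonneg[OF hol re f0 z r])
  also have "\<dots> \<le> 3 * lrad W" using exp_ge_add_one_self[of "- lrad W"] by simp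
  finally have fz: "norm (f z) \<le> 3 * lrad W" .
  have "?q z \<noteq> 0" using q1[of z] z r by auto
  moreover have "?g z = z * ?q z"
    using nconf_norm_conf_map[OF W(1)] by (auto simp: cquot_def nconf_def)
  ultimately have "?g z - z = ?g z * f z" by (simp add: f_def right_diff_distrib)
  moreover have "norm (?g z) \<le> 1" using nconf_norm_less[OF nconf_norm_conf_map[OF W(1)] zW] by simp
  ultimately show ?thesis
    using fz mult_mono[of "norm (?g z)" 1 "norm (f z)" "3 * lrad W"] by (simp add: norm_mult)
qed

lemma lrad_antimono:
  assumes "adm W" "adm W'" "W \<subseteq> W'"
  shows "lrad W' \<le> lrad W"
  using lrad_strict_antimono[OF assms(1,2)] assms(3) by (cases "W = W'") (auto simp: psubset_eq)

text \<open>Normalised by the capacity, the difference quotients have derivative tending to \<open>1\<close> at the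
  origin, so along any sequence the quotient of time and capacity has the same limit.\<close>
lemma differentiable_imp_capacity_rate:
  fixes W :: "real \<Rightarrow> complex set"
  assumes W: "\<And>t. t \<in> {0..T} \<Longrightarrow> adm (W t)" "\<And>t. t \<in> {0..T} \<Longrightarrow> ball 0 r \<subseteq> W t" and r: "0 < r"
    and g0: "\<And>z. z \<in> ball 0 r \<Longrightarrow> norm_conf_map (W 0) z = z"
    and diff: "\<And>z. z \<in> ball 0 r \<Longrightarrow> (\<lambda>t. norm_conf_map (W t) z) differentiable (at 0 within {0..T})"
  obtains c where "\<And>t \<tau>. (\<And>n. t n \<in> {0<..T}) \<Longrightarrow> t \<longlonglongrightarrow> 0 \<Longrightarrow> (\<And>n. 0 < lrad (W (t n))) \<Longrightarrow>
      (\<lambda>n. lrad (W (t n))) \<longlonglongrightarrow> 0 \<Longrightarrow> (\<lambda>n. t n / lrad (W (t n))) \<longlonglongrightarrow> \<tau> \<Longrightarrow> c * complex_of_real \<tau> = 1"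
proof -
  define D where "D = (\<lambda>z. vector_derivative (\<lambda>t. norm_conf_map (W t) z) (at 0 within {0..T}))"
  have D: "(\<lambda>n. (norm_conf_map (W (t n)) z - z) / of_real (t n)) \<longlonglongrightarrow> D z"
    if z: "z \<in> ball 0 r" and t: "\<And>n. t n \<in> {0<..T}" "t \<longlonglongrightarrow> 0" for z and t :: "nat \<Rightarrow> real"
  proof -
    let ?f = "\<lambda>t. norm_conf_map (W t) z"
    have "(?f has_vector_derivative D z) (at 0 within {0..T})"
      unfolding D_def using diff[OF z] by (simp add: vector_derivative_works)
    then have "((\<lambda>y. (1 / norm (y - 0)) *\<^sub>R (?f y - (?f 0 + (y - 0) *\<^sub>R D z))) \<longlongrightarrow> 0) (at 0 within {0..T})"
      unfolding has_vector_derivative_def has_derivative_within by blast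
    moreover have "filterlim t (at 0 within {0..T}) sequentially"
    proof -
      have "t n \<in> {0..T} \<and> t n \<noteq> 0" for n using t(1)[of n] by auto
      then show ?thesis using t(2) by (simp add: filterlim_at)
    qed
    ultimately have "(\<lambda>n. (1 / norm (t n - 0)) *\<^sub>R (?f (t n) - (?f 0 + (t n - 0) *\<^sub>R D z))) \<longlonglongrightarrow> 0"
      by (rule filterlim_compose)
    moreover have "(1 / norm (t n - 0)) *\<^sub>R (?f (t n) - (?f 0 + (t n - 0) *\<^sub>R D z)) = (?f (t n) - z) / of_real (t n) - D z" for n
    proof -
      have "0 < t n" using t(1)[of n] by simp
      then show ?thesis by (simp add: g0[OF z] scaleR_conv_of_real field_simps)
    qed
    ultimately have "(\<lambda>n. (?f (t n) - z) / of_real (t n) - D z) \<longlonglongrightarrow> 0" by simp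
    then show ?thesis by (simp add: LIM_zero_iff)
  qed
  show thesis
  \<comment> \<open>The constant is fixed before any sequence is chosen, hence common to all of
    them. That \<open>D\<close> is holomorphic near 0 is not known beforehand; it appears there as a
    multiple of the Montel limit.\<close>
  proof (rule that[of "deriv D 0"])
    fix t :: "nat \<Rightarrow> real" and \<tau>
    assume t: "\<And>n. t n \<in> {0<..T}" "t \<longlonglongrightarrow> 0" "\<And>n. 0 < lrad (W (t n))"
      and J0: "(\<lambda>n. lrad (W (t n))) \<longlonglongrightarrow> 0" and \<tau>: "(\<lambda>n. t n / lrad (W (t n))) \<longlonglongrightarrow> \<tau>"
    let ?J = "\<lambda>n. lrad (W (t n))" and ?g = "\<lambda>n. norm_conf_map (W (t n))"
    let ?B = "ball (0::complex) (r / 2)"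
    have tT: "t n \<in> {0..T}" for n using t(1)[of n] by auto
    note Wn = W(1)[OF tT] and Bn = W(2)[OF tT]
    \<comment> \<open>Dividing by capacity instead of time gives a family bounded by 3, as Montel
      requires; the ratio of time to capacity enters only through the pointwise limit.\<close>
    define Q where "Q = (\<lambda>n z. (?g n z - z) / of_real (?J n))"
    have sub: "?B \<subseteq> W (t n)" for n using Bn[of n] r by (auto intro: order_trans[OF subset_ball])
    have holg: "?g n holomorphic_on ?B" for n
      using nconf_norm_conf_map[OF Wn[of n]] sub[of n] by (auto simp: nconf_def intro: holomorphic_on_subset)
    have holQ: "Q n holomorphic_on ?B" for n
      unfolding Q_def using holg[of n] t(3)[of n] by (intro holomorphic_intros) auto
    have bd: "norm (Q n z) \<le> 3" if "z \<in> ?B" for n z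
    proof -
      have "norm (?g n z - z) \<le> 3 * ?J n"
        using that by (intro norm_conf_map_near_id[OF Wn Bn _ r]) simp
      then show ?thesis using t(3)[of n] by (simp add: Q_def norm_divide divide_le_eq)
    qed
    have hol: "h holomorphic_on ?B" if "h \<in> range Q" for h using that holQ by blast
    have bdd: "\<exists>b. \<forall>h\<in>range Q. \<forall>z\<in>K. norm (h z) \<le> b" if "compact K" "K \<subseteq> ?B" for K
      using bd that by (intro exI[of _ 3]) blast
    obtain G k where G: "G holomorphic_on ?B" "strict_mono (k :: nat \<Rightarrow> nat)"
        "\<And>x. x \<in> ?B \<Longrightarrow> ((\<lambda>n. Q (k n) x) \<longlongrightarrow> G x) sequentially"
        "\<And>K. \<lbrakk>compact K; K \<subseteq> ?B\<rbrakk> \<Longrightarrow> uniform_limit K (Q \<circ> k) G sequentially"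
      using Montel[where \<F> = Q and \<H> = "range Q", OF open_ball hol bdd order_refl] by blast
    have lim: "(\<lambda>n. Q n z) \<longlonglongrightarrow> of_real \<tau> * D z" if "z \<in> ?B" for z
    proof -
      have "z \<in> ball 0 r" using that r by simp
      from tendsto_mult[OF tendsto_of_real[OF \<tau>] D[OF this t(1,2)]]
      have "(\<lambda>n. of_real (t n / ?J n) * ((?g n z - z) / of_real (t n))) \<longlonglongrightarrow> of_real \<tau> * D z" .
      moreover have "of_real (t n / ?J n) * ((?g n z - z) / of_real (t n)) = Q n z" for n
        using t(1)[of n] by (simp add: Q_def)
      ultimately show ?thesis by simp
    qed
    have GD: "G z = of_real \<tau> * D z" if "z \<in> ?B" for z
      using LIMSEQ_unique[OF G(3)[OF that]] LIMSEQ_subseq_LIMSEQ[OF lim[OF that] G(2)] by (simp add: comp_def)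
    have "uniform_limit (cball 0 (r/4)) (Q \<circ> k) G sequentially" using r by (intro G(4)) auto
    then have "uniform_limit (ball 0 (r/4)) (\<lambda>n. Q (k n)) G sequentially"
      unfolding comp_def by (rule uniform_limit_on_subset) auto
    then have "(\<lambda>n. deriv (Q (k n)) 0) \<longlonglongrightarrow> deriv G 0"
      by (rule deriv_complex_uniform_limit)
         (use r in \<open>auto intro!: always_eventually holomorphic_on_subset[OF holQ]\<close>)
    \<comment> \<open>The derivative of the map at 0 is the exponential of its capacity, so these
      numbers tend to 1 for every admissible sequence.\<close>
    moreover have "deriv (Q n) 0 = of_real ((exp (?J n) - 1) / ?J n)" for n
    proof -
      have "(?g n has_field_derivative of_real (exp (?J n))) (at 0)"
        using holg[of n] r unfolding exp_lrad(2)[OF Wn, symmetric] by (intro holomorphic_derivI) auto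
      then have "(Q n has_field_derivative (of_real (exp (?J n)) - 1) / of_real (?J n)) (at 0)"
        unfolding Q_def using t(3)[of n] by (auto intro!: derivative_eq_intros)
      then show ?thesis by (simp add: DERIV_imp_deriv)
    qed
    moreover have "(\<lambda>n. (exp (?J (k n)) - 1) / ?J (k n)) \<longlonglongrightarrow> 1"
    proof -
      have "((\<lambda>x::real. (exp x - 1) / x) \<longlongrightarrow> 1) (at 0)"
        using DERIV_exp[of "0::real"] unfolding DERIV_def by simp
      moreover have "filterlim (\<lambda>n. ?J (k n)) (at 0) sequentially"
        using LIMSEQ_subseq_LIMSEQ[OF J0 G(2)] t(3) by (simp add: filterlim_at comp_def less_imp_neq[THEN not_sym])
      ultimately show ?thesis by (rule filterlim_compose)
    qed
    ultimately have "(\<lambda>n. complex_of_real ((exp (?J (k n)) - 1) / ?J (k n))) \<longlonglongrightarrow> deriv G 0"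
      "(\<lambda>n. complex_of_real ((exp (?J (k n)) - 1) / ?J (k n))) \<longlonglongrightarrow> of_real 1"
      by (simp_all only: tendsto_of_real_iff)
    then have G1: "deriv G 0 = 1" using LIMSEQ_unique by fastforce
    have ev: "eventually (\<lambda>z. z \<in> ?B) (nhds 0)" using r by (intro eventually_nhds_in_open) auto
    have "\<tau> \<noteq> 0"
    proof
      assume "\<tau> = 0"
      then have "deriv G 0 = deriv (\<lambda>_. 0) 0"
        using ev by (intro deriv_cong_ev refl) (auto elim!: eventually_mono simp: GD)
      with G1 show False by simp
    qed
    have "deriv D 0 = deriv (\<lambda>z. G z / of_real \<tau>) 0"
      using ev \<open>\<tau> \<noteq> 0\<close> by (intro deriv_cong_ev refl) (auto elim!: eventually_mono simp: GD)
    also have "\<dots> = deriv G 0 / of_real \<tau>"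
    proof -
      have "(G has_field_derivative deriv G 0) (at 0)"
        using G(1) r by (intro holomorphic_derivI) auto
      then have "((\<lambda>z. G z / of_real \<tau>) has_field_derivative deriv G 0 / of_real \<tau>) (at 0)"
        by (rule DERIV_cdivide)
      then show ?thesis by (rule DERIV_imp_deriv)
    qed
    finally show "deriv D 0 * of_real \<tau> = 1" using G1 \<open>\<tau> \<noteq> 0\<close> by simp
  qed
qed

section \<open>The two curves\<close>

lemma cap1_strict_mono:
  assumes \<phi>: "continuous_on UNIV \<phi>" and s: "0 \<le> s" "s < s'" "s' < 1"
  shows "cap1 \<phi> s < cap1 \<phi> s'"
proof (rule lrad_strict_antimono)
  have c: "continuous_on A \<phi>" for A using \<phi> by (rule continuous_on_subset) simp
  show "adm (slitdom (pcurve \<phi> s'))" "adm (slitdom (pcurve \<phi> s))"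
    using s c by (auto intro!: adm_slitdom is_hull_pcurve)
  have eq: "slitdom (pcurve \<phi> s) = ball 0 1 - pcurve \<phi> s" "slitdom (pcurve \<phi> s') = ball 0 1 - pcurve \<phi> s'"
    by (rule slitdom_pcurve[OF c]; use s in simp)+
  let ?w = "of_real (1 - s') * cis (\<phi> s')"
  have n: "norm ?w = 1 - s'" using s by (simp add: norm_mult del: of_real_diff)
  have "?w \<in> pcurve \<phi> s'" unfolding pcurve_def using s by (intro imageI) auto
  moreover have "?w \<notin> pcurve \<phi> s" using pcurve_norm[of ?w \<phi> s] s n by auto
  moreover have "?w \<in> ball 0 1" using n s by (simp del: of_real_diff)
  moreover have "pcurve \<phi> s \<subseteq> pcurve \<phi> s'" unfolding pcurve_def using s by (intro image_mono) auto
  ultimately show "slitdom (pcurve \<phi> s') \<subset> slitdom (pcurve \<phi> s)" unfolding eq by blast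
qed

lemma
  assumes \<phi>: "continuous_on UNIV \<phi>"
  shows continuous_on_cap1: "continuous_on {0..<1} (cap1 \<phi>)"
    and continuous_on_cap2: "continuous_on {0..<1} (cap2 \<phi>)"
proof -
  have c: "continuous_on A \<phi>" for A using \<phi> by (rule continuous_on_subset) simp
  have *: "(\<lambda>n. \<phi> (un n)) \<longlonglongrightarrow> \<phi> u" if "un \<longlonglongrightarrow> u" for un :: "nat \<Rightarrow> real" and u
    using continuous_on_tendsto_compose[OF \<phi> that] by simp
  have "(\<lambda>n. cap1 \<phi> (x n)) \<longlonglongrightarrow> cap1 \<phi> a \<and> (\<lambda>n. cap2 \<phi> (x n)) \<longlonglongrightarrow> cap2 \<phi> a"
    if "a \<in> {0..<1}" "\<And>n. x n \<in> {0..<1}" "x \<longlonglongrightarrow> a" for x :: "nat \<Rightarrow> real" and a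
  proof
    have x: "0 \<le> x n" "x n < 1" for n using that(2)[of n] by auto
    show "(\<lambda>n. cap1 \<phi> (x n)) \<longlonglongrightarrow> cap1 \<phi> a"
      by (rule lrad_pcurve_tendsto[where \<phi>n = "\<lambda>_. \<phi>"]) (use that x c * in auto)
    show "(\<lambda>n. cap2 \<phi> (x n)) \<longlonglongrightarrow> cap2 \<phi> a"
      by (rule lrad_pcurve2_tendsto[where \<phi>n = "\<lambda>_. \<phi>"]) (use that x c * in auto)
  qed
  then show "continuous_on {0..<1} (cap1 \<phi>)" "continuous_on {0..<1} (cap2 \<phi>)"
    unfolding continuous_on_sequentially comp_def by blast+
qed

lemma slitdom_pcurve_0: "slitdom (pcurve \<phi> 0) = ball 0 1" "slitdom (pcurve2 \<phi> 0) = ball 0 1"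
proof -
  have K: "is_hull (pcurve \<phi> 0)" "is_hull (pcurve2 \<phi> 0)"
    by (auto intro!: is_hull_pcurve is_hull_pcurve2)
  have "ball 0 1 - pcurve \<phi> 0 = ball 0 1" "ball 0 1 - pcurve2 \<phi> 0 = ball 0 1"
    by (auto simp: pcurve2_def pcurve_def)
  then show "slitdom (pcurve \<phi> 0) = ball 0 1" "slitdom (pcurve2 \<phi> 0) = ball 0 1"
    using slitdom_eq[OF K(1)] slitdom_eq[OF K(2)] by simp_all
qed

lemma norm_conf_map_ball: "z \<in> ball 0 1 \<Longrightarrow> norm_conf_map (ball 0 1) z = z"
  using nconf_unique[OF _ _ nconf_norm_conf_map[OF adm_ball], of "\<lambda>z. z" z] by (auto simp: nconf_def)

text \<open>When time is capacity, the function whose differentiability is asked is the identity on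
  \<open>{0..T}\<close>.\<close>

lemma loewner_param_atI:
  assumes "\<And>t. t \<in> {0..T} \<Longrightarrow> ball 0 1 - \<gamma> ` {0..t} = W t" "\<And>t. t \<in> {0..T} \<Longrightarrow> lrad (W t) = t" "t0 \<in> {0..T}"
  shows "loewner_param_at \<gamma> T t0"
proof -
  have eq: "ln (Re (deriv (hmap \<gamma> t) 0)) = t" if "t \<in> {0..T}" for t
    using assms(2)[OF that] unfolding hmap_def assms(1)[OF that] lrad_def .
  have "((\<lambda>t. ln (Re (deriv (hmap \<gamma> t) 0))) has_derivative (\<lambda>x. x)) (at t0 within {0..T})"
    by (rule has_derivative_transform[OF assms(3) eq has_derivative_ident]) 
  then show ?thesis unfolding loewner_param_at_def differentiable_def by blast
qed

theorem theorem2: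
  shows "\<exists>T::real. T > 0 \<and> (\<exists>\<gamma>1 \<gamma>2 :: real \<Rightarrow> complex. \<exists>p.
    continuous_on {0..T} \<gamma>1 \<and> inj_on \<gamma>1 {0..T} \<and>
    continuous_on {0..T} \<gamma>2 \<and> inj_on \<gamma>2 {0..T} \<and>
    \<gamma>1 ` {0..T} \<subseteq> cball 0 1 - {0} \<and> \<gamma>2 ` {0..T} \<subseteq> cball 0 1 - {0} \<and>
    norm (\<gamma>1 0) = 1 \<and> norm (\<gamma>2 0) = 1 \<and>
    \<gamma>1 ` {0<..T} \<subseteq> ball 0 1 - {0} \<and> \<gamma>2 ` {0<..T} \<subseteq> ball 0 1 - {0} \<and>
    \<gamma>1 ` {0<..T} \<inter> \<gamma>2 ` {0<..T} = {} \<and>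
    closure (\<gamma>1 ` {0<..T}) \<inter> closure (\<gamma>2 ` {0<..T}) = {p} \<and> norm p = 1 \<and>
    (\<forall>t0\<in>{0..T}. loewner_param_at \<gamma>1 T t0) \<and>
    (\<forall>t0\<in>{0..T}. loewner_param_at \<gamma>2 T t0) \<and>
    \<not> (\<forall>z \<in> ball 0 1 - (\<gamma>1 ` {0..T} \<union> \<gamma>2 ` {0..T}).
          (\<lambda>t. gmap \<gamma>1 \<gamma>2 t z) differentiable (at 0 within {0..T})))"
proof -
  obtain \<phi> :: "real \<Rightarrow> real" where \<phi>: "continuous_on UNIV \<phi>" "\<phi> 0 = 0"
      "\<And>u. 0 < u \<Longrightarrow> u \<le> 1 \<Longrightarrow> 0 < \<phi> u \<and> \<phi> u \<le> 1"
    and low: "\<And>d. 0 < d \<Longrightarrow> \<exists>s. 0 < s \<and> s < d \<and> s \<le> 1/2 \<and> cap2 \<phi> s < (1 + d) * cap1 \<phi> s"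
    and high: "\<And>d. 0 < d \<Longrightarrow> \<exists>s. 0 < s \<and> s < d \<and> s \<le> 1/2 \<and> 5/4 * cap1 \<phi> s < cap2 \<phi> s"
    using ex_oscillating_profile by blast
  have c\<phi>: "continuous_on A \<phi>" for A using \<phi>(1) by (rule continuous_on_subset) simp
  have m\<phi>: "continuous_on UNIV (\<lambda>u. - \<phi> u)" using \<phi>(1) by (intro continuous_intros)
  define C where "C = cap1 \<phi>"
  \<comment> \<open>Stopping at depth 1/2 keeps both curves off the ball of radius 1/2, on which the
    joint maps are compared for all times.\<close>
  define T where "T = C (1/2)"
  have C0: "C 0 = 0" by (simp add: C_def slitdom_pcurve_0 lrad_ball)
  have Cless: "C s < C s'" if "0 \<le> s" "s < s'" "s' \<le> 1/2" for s s'
    unfolding C_def using that by (intro cap1_strict_mono \<phi>) auto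
  have Cle: "C s \<le> C s' \<longleftrightarrow> s \<le> s'" if "s \<in> {0..1/2}" "s' \<in> {0..1/2}" for s s'
    using Cless[of s s'] Cless[of s' s] that by (cases s s' rule: linorder_cases) auto
  have T: "0 < T" using Cless[of 0 "1/2"] C0 by (simp add: T_def)
  have contC: "continuous_on {0..1/2} C"
    unfolding C_def using continuous_on_cap1[OF \<phi>(1)] by (rule continuous_on_subset) auto
  have injC: "inj_on C {0..1/2}" using Cle by (intro inj_onI) (metis order_antisym order_refl)
  have imC: "C ` {0..1/2} = {0..T}"
  proof
    show "C ` {0..1/2} \<subseteq> {0..T}" using Cle[of 0] Cle[of _ "1/2"] C0 by (auto simp: T_def)
    show "{0..T} \<subseteq> C ` {0..1/2}"
    proof
      fix t assume "t \<in> {0..T}"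
      then obtain x where "0 \<le> x" "x \<le> 1/2" "C x = t"
        using IVT'[of C 0 t "1/2"] contC C0 by (auto simp: T_def)
      then show "t \<in> C ` {0..1/2}" by auto
    qed
  qed
  \<comment> \<open>Depth as a function of capacity; both curves use the same
    \<open>\<sigma>\<close> since mirror images have equal capacity.\<close>
  define \<sigma> where "\<sigma> = the_inv_into {0..1/2} C"
  have \<sigma>C: "\<sigma> (C s) = s" if "s \<in> {0..1/2}" for s
    unfolding \<sigma>_def using injC that by (rule the_inv_into_f_f)
  have \<sigma>: "\<sigma> t \<in> {0..1/2}" "C (\<sigma> t) = t" if "t \<in> {0..T}" for t
  proof -
    have "t \<in> C ` {0..1/2}" unfolding imC by (rule that)
    then obtain s where "s \<in> {0..1/2}" "t = C s" by (rule imageE)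
    then show "\<sigma> t \<in> {0..1/2}" "C (\<sigma> t) = t" using \<sigma>C by auto
  qed
  have cont\<sigma>: "continuous_on {0..T} \<sigma>"
    using continuous_on_inv[OF contC compact_Icc, of \<sigma>] \<sigma>C imC by auto
  have \<sigma>0: "\<sigma> 0 = 0" using \<sigma>C[of 0] C0 by simp
  have \<sigma>im: "\<sigma> ` {0..t} = {0..\<sigma> t}" if t: "t \<in> {0..T}" for t
  proof (intro equalityI subsetI)
    fix s assume "s \<in> \<sigma> ` {0..t}"
    then obtain t' where "s = \<sigma> t'" "0 \<le> t'" "t' \<le> t" by auto
    then show "s \<in> {0..\<sigma> t}" using \<sigma>[of t'] \<sigma>[OF t] Cle[of "\<sigma> t'" "\<sigma> t"] t by auto
  next
    fix s assume s: "s \<in> {0..\<sigma> t}"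
    then have s': "s \<in> {0..1/2}" using \<sigma>[OF t] by auto
    have "C s \<le> t" "0 \<le> C s" using Cle[of s "\<sigma> t"] Cle[of 0 s] s s' \<sigma>[OF t] C0 by auto
    then show "s \<in> \<sigma> ` {0..t}" using \<sigma>C[OF s'] by (intro image_eqI[of _ _ "C s"]) auto
  qed
  have \<sigma>pos: "0 < \<sigma> t" if "t \<in> {0<..T}" for t
    using \<sigma>[of t] C0 that by (cases "\<sigma> t = 0") auto
  define \<gamma> where "\<gamma> = (\<lambda>f t. of_real (1 - \<sigma> t) * cis (f (\<sigma> t)) :: complex)"
  have im: "\<gamma> f ` {0..t} = pcurve f (\<sigma> t)" if "t \<in> {0..T}" for f t
    using \<sigma>im[OF that] unfolding pcurve_def \<gamma>_def by (metis (no_types, lifting) image_cong image_image)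
  have norm\<gamma>: "norm (\<gamma> f t) = 1 - \<sigma> t" if "t \<in> {0..T}" for f t
    using \<sigma>(1)[OF that] by (simp add: \<gamma>_def norm_mult del: of_real_diff)
  have cont\<gamma>: "continuous_on {0..T} (\<gamma> f)" if "continuous_on UNIV f" for f
    unfolding \<gamma>_def using continuous_on_compose2[OF that cont\<sigma>] cont\<sigma> by (intro continuous_intros) auto
  have inj\<gamma>: "inj_on (\<gamma> f) {0..T}" for f
  proof (rule inj_onI)
    fix x y assume "x \<in> {0..T}" "y \<in> {0..T}" "\<gamma> f x = \<gamma> f y"
    then show "x = y" using norm\<gamma>[of x f] norm\<gamma>[of y f] \<sigma>(2) by (metis diff_left_imp_eq)
  qed
  have sub\<gamma>: "\<gamma> f ` {0..T} \<subseteq> cball 0 1 - {0}" for f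
  proof
    fix w assume "w \<in> \<gamma> f ` {0..T}"
    then obtain t where "t \<in> {0..T}" "w = \<gamma> f t" by blast
    then have "1/2 \<le> norm w" "norm w \<le> 1" using norm\<gamma>[of t f] \<sigma>(1)[of t] by auto
    then show "w \<in> cball 0 1 - {0}" by auto
  qed
  have sub\<gamma>': "\<gamma> f ` {0<..T} \<subseteq> ball 0 1 - {0}" for f
  proof
    fix w assume "w \<in> \<gamma> f ` {0<..T}"
    then obtain t where "t \<in> {0<..T}" "w = \<gamma> f t" by blast
    then have "1/2 \<le> norm w" "norm w < 1" using norm\<gamma>[of t f] \<sigma>(1)[of t] \<sigma>pos[of t] by auto
    then show "w \<in> ball 0 1 - {0}" by auto
  qed
  define \<gamma>1 where "\<gamma>1 = \<gamma> \<phi>"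
  define \<gamma>2 where "\<gamma>2 = \<gamma> (\<lambda>u. - \<phi> u)"
  have \<gamma>0: "\<gamma>1 0 = 1" "\<gamma>2 0 = 1" by (simp_all add: \<gamma>1_def \<gamma>2_def \<gamma>_def \<sigma>0 \<phi>(2))
  \<comment> \<open>Equal norms force equal depths, hence equal times; at positive depth the angles
    \<open>\<phi>\<close> and \<open>- \<phi>\<close> have different sines.\<close>
  have meet: "w = 1" if "w \<in> \<gamma>1 ` {0..T}" "w \<in> \<gamma>2 ` {0..T}" for w
  proof -
    obtain t t' where t: "t \<in> {0..T}" "w = \<gamma>1 t" "t' \<in> {0..T}" "w = \<gamma>2 t'" using \<open>w \<in> \<gamma>1 ` {0..T}\<close> \<open>w \<in> \<gamma>2 ` {0..T}\<close> by blast
    have "1 - \<sigma> t = 1 - \<sigma> t'"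
      using norm\<gamma>[OF t(1), of \<phi>] norm\<gamma>[OF t(3), of "\<lambda>u. - \<phi> u"] t(2,4) by (simp add: \<gamma>1_def \<gamma>2_def)
    then have "\<sigma> t = \<sigma> t'" by simp
    then have "t = t'" using \<sigma>(2)[OF t(1)] \<sigma>(2)[OF t(3)] by metis
    have "t = 0"
    proof (rule ccontr)
      assume "t \<noteq> 0"
      then have "0 < \<sigma> t" using \<sigma>pos[of t] t(1) by auto
      then have u: "0 < \<phi> (\<sigma> t)" "\<phi> (\<sigma> t) \<le> 1" "\<sigma> t \<le> 1/2" using \<phi>(3)[of "\<sigma> t"] \<sigma>(1)[OF t(1)] by auto
      have "of_real (1 - \<sigma> t) * cis (\<phi> (\<sigma> t)) = of_real (1 - \<sigma> t) * cis (- \<phi> (\<sigma> t))"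
        using t(2,4) unfolding \<open>t = t'\<close> \<gamma>1_def \<gamma>2_def \<gamma>_def by (rule trans[OF sym])
      moreover have "complex_of_real (1 - \<sigma> t) \<noteq> 0" using u(3) by (simp del: of_real_diff)
      ultimately have "cis (\<phi> (\<sigma> t)) = cis (- \<phi> (\<sigma> t))" by (metis mult_left_cancel)
      then have "sin (\<phi> (\<sigma> t)) = 0" by (auto simp: complex_eq_iff)
      moreover have "0 < sin (\<phi> (\<sigma> t))" using u pi_gt3 by (intro sin_gt_zero) auto
      ultimately show False by simp
    qed
    then show ?thesis using t(2) \<gamma>0 by simp
  qed
  have cont: "continuous_on {0..T} \<gamma>1" "continuous_on {0..T} \<gamma>2"
    unfolding \<gamma>1_def \<gamma>2_def using cont\<gamma> \<phi>(1) m\<phi> by blast+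
  have disj: "\<gamma>1 ` {0<..T} \<inter> \<gamma>2 ` {0<..T} = {}"
  proof -
    have False if w: "w \<in> \<gamma>1 ` {0<..T}" "w \<in> \<gamma>2 ` {0<..T}" for w
    proof -
      have "{0<..T} \<subseteq> {0..T}" by auto
      then have "w = 1" using w by (meson meet image_mono subsetD)
      moreover have "w \<in> ball 0 1 - {0}" using w(1) sub\<gamma>'[of \<phi>] unfolding \<gamma>1_def by (rule rev_subsetD)
      ultimately show False by simp
    qed
    then show ?thesis unfolding disjoint_iff by metis
  qed
  have clos: "closure (\<gamma>1 ` {0<..T}) \<inter> closure (\<gamma>2 ` {0<..T}) = {1}"
  proof -
    have clT: "closure {0<..T} = {0..T}" using T by simp
    have up: "closure (g ` {0<..T}) \<subseteq> g ` {0..T}" if "continuous_on {0..T} g" for g :: "real \<Rightarrow> complex"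
      using compact_imp_closed[OF compact_continuous_image[OF that compact_Icc]]
      by (intro closure_minimal image_mono) auto
    have dn: "g 0 \<in> closure (g ` {0<..T})" if "continuous_on {0..T} g" for g :: "real \<Rightarrow> complex"
    proof -
      have "g ` closure {0<..T} \<subseteq> closure (g ` {0<..T})"
        using that by (intro image_closure_subset) (auto simp: clT closure_subset)
      then show ?thesis using T unfolding clT by auto
    qed
    show ?thesis using up[OF cont(1)] up[OF cont(2)] dn[OF cont(1)] dn[OF cont(2)] meet \<gamma>0 by auto
  qed
  have dom1: "ball 0 1 - \<gamma>1 ` {0..t} = slitdom (pcurve \<phi> (\<sigma> t))" if "t \<in> {0..T}" for t
    unfolding \<gamma>1_def im[OF that] using \<sigma>(1)[OF that] c\<phi> by (subst slitdom_pcurve) auto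
  have dom2: "ball 0 1 - \<gamma>2 ` {0..t} = slitdom (pcurve (\<lambda>u. - \<phi> u) (\<sigma> t))" if "t \<in> {0..T}" for t
    unfolding \<gamma>2_def im[OF that] using \<sigma>(1)[OF that] continuous_on_subset[OF m\<phi>]
    by (subst slitdom_pcurve) auto
  have lp1: "loewner_param_at \<gamma>1 T t0" if "t0 \<in> {0..T}" for t0
    using dom1 \<sigma>(2) that by (intro loewner_param_atI[of T \<gamma>1 "\<lambda>t. slitdom (pcurve \<phi> (\<sigma> t))"]) (auto simp: C_def)
  have lp2: "loewner_param_at \<gamma>2 T t0" if "t0 \<in> {0..T}" for t0
  proof (rule loewner_param_atI[OF dom2 _ that])
    fix t assume t: "t \<in> {0..T}"
    have "cap1 (\<lambda>u. - \<phi> u) (\<sigma> t) = cap1 \<phi> (\<sigma> t)"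
      using \<sigma>(1)[OF t] by (intro lrad_pcurve_uminus c\<phi>) auto
    then show "cap1 (\<lambda>u. - \<phi> u) (\<sigma> t) = t" using \<sigma>(2)[OF t] by (simp add: C_def)
  qed
  define W where "W = (\<lambda>t. slitdom (pcurve2 \<phi> (\<sigma> t)))"
  have domW: "ball 0 1 - (\<gamma>1 ` {0..t} \<union> \<gamma>2 ` {0..t}) = W t" if t: "t \<in> {0..T}" for t
  proof -
    have s: "0 \<le> \<sigma> t" "\<sigma> t < 1" using \<sigma>(1)[OF t] by auto
    have "W t = ball 0 1 - pcurve2 \<phi> (\<sigma> t)"
      unfolding W_def using s \<phi>(3) c\<phi> by (intro slitdom_eq is_hull_pcurve2 connected_ball_minus_pcurve2) auto
    then show ?thesis unfolding \<gamma>1_def \<gamma>2_def im[OF t] by (simp add: pcurve2_def)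
  qed
  have admW: "adm (W t)" if "t \<in> {0..T}" for t
    unfolding W_def using \<sigma>(1)[OF that] c\<phi> by (intro adm_slitdom is_hull_pcurve2) auto
  have ballW: "ball 0 (1/2) \<subseteq> W t" if t: "t \<in> {0..T}" for t
  proof
    fix z :: complex assume "z \<in> ball 0 (1/2)"
    then have "z \<in> ball 0 1 - pcurve2 \<phi> (\<sigma> t)"
      using pcurve_norm[of z \<phi> "\<sigma> t"] pcurve_norm[of z "\<lambda>u. - \<phi> u" "\<sigma> t"] \<sigma>(1)[OF t]
      by (auto simp: pcurve2_def)
    then show "z \<in> W t" using domW[OF t] unfolding \<gamma>1_def \<gamma>2_def im[OF t] by (simp add: pcurve2_def)
  qed
  have lradW: "lrad (W (C s)) = cap2 \<phi> s" if "s \<in> {0..1/2}" for s using \<sigma>C[OF that] by (simp add: W_def)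
  have "\<not> (\<forall>z \<in> ball 0 1 - (\<gamma>1 ` {0..T} \<union> \<gamma>2 ` {0..T}).
          (\<lambda>t. gmap \<gamma>1 \<gamma>2 t z) differentiable (at 0 within {0..T}))"
  proof
    assume *: "\<forall>z \<in> ball 0 1 - (\<gamma>1 ` {0..T} \<union> \<gamma>2 ` {0..T}).
          (\<lambda>t. gmap \<gamma>1 \<gamma>2 t z) differentiable (at 0 within {0..T})"
    have TT: "T \<in> {0..T}" "0 \<in> {0..T}" using T by auto
    have diff: "(\<lambda>t. norm_conf_map (W t) z) differentiable (at 0 within {0..T})" if z: "z \<in> ball 0 (1/2)" for z
    proof -
      have "(\<lambda>t. gmap \<gamma>1 \<gamma>2 t z) differentiable (at 0 within {0..T})"
        using * ballW[OF TT(1)] z unfolding domW[OF TT(1)] by blast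
      then obtain d where d: "((\<lambda>t. gmap \<gamma>1 \<gamma>2 t z) has_derivative d) (at 0 within {0..T})"
        unfolding differentiable_def by blast
      have "norm_conf_map (W t) z = gmap \<gamma>1 \<gamma>2 t z" if "t \<in> {0..T}" for t
        by (simp add: gmap_def domW[OF that])
      from has_derivative_transform[OF TT(2) this d] show ?thesis
        unfolding differentiable_def by blast
    qed
    have W0: "norm_conf_map (W 0) z = z" if "z \<in> ball 0 (1/2)" for z
      using that by (simp add: W_def \<sigma>0 slitdom_pcurve_0 norm_conf_map_ball)
    have half: "(0::real) < 1/2" by simp
    obtain c where c: "\<And>t \<tau>. (\<And>n. t n \<in> {0<..T}) \<Longrightarrow> t \<longlonglongrightarrow> 0 \<Longrightarrow> (\<And>n. 0 < lrad (W (t n))) \<Longrightarrow>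
      (\<lambda>n. lrad (W (t n))) \<longlonglongrightarrow> 0 \<Longrightarrow> (\<lambda>n. t n / lrad (W (t n))) \<longlonglongrightarrow> \<tau> \<Longrightarrow> c * complex_of_real \<tau> = 1"
      using differentiable_imp_capacity_rate[OF admW ballW half W0 diff] by blast
    have cap12: "0 < cap1 \<phi> s" "cap1 \<phi> s \<le> cap2 \<phi> s" if "0 < s" "s \<le> 1/2" for s
    proof -
      show "0 < cap1 \<phi> s" using that c\<phi> by (intro lrad_pcurve_pos) auto
      show "cap1 \<phi> s \<le> cap2 \<phi> s"
        using that c\<phi> by (intro lrad_antimono adm_slitdom is_hull_pcurve is_hull_pcurve2 slitdom_antimono)
          (auto simp: pcurve2_def)
    qed
    \<comment> \<open>The time at depth \<open>s\<close> is \<open>cap1 \<phi> s\<close>, so the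
      ratio of time to joint capacity is \<open>cap1 \<phi> s / cap2 \<phi> s\<close>.\<close>
    have rate: "c * complex_of_real \<tau> = 1"
      if s: "\<And>n. 0 < s n" "\<And>n. s n \<le> 1/2" "s \<longlonglongrightarrow> 0" and lim: "(\<lambda>n. cap1 \<phi> (s n) / cap2 \<phi> (s n)) \<longlonglongrightarrow> \<tau>"
      for s :: "nat \<Rightarrow> real" and \<tau>
    proof -
      have s': "s n \<in> {0..1/2}" "s n \<in> {0..<1}" for n using s(1,2)[of n] by auto
      have J: "lrad (W (C (s n))) = cap2 \<phi> (s n)" for n using lradW[OF s'(1)] .
      show ?thesis
      proof (rule c[of "\<lambda>n. C (s n)"], unfold J)
        show "C (s n) \<in> {0<..T}" for n
          using Cle[of "s n" "1/2"] s' cap12(1)[OF s(1,2)] by (simp add: T_def C_def)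
        show "(\<lambda>n. C (s n)) \<longlonglongrightarrow> 0"
          using continuous_on_tendsto_compose[OF continuous_on_cap1[OF \<phi>(1)] s(3)] s'(2) C0 by (simp add: C_def)
        have "cap2 \<phi> 0 = 0" by (simp add: slitdom_pcurve_0 lrad_ball)
        then show "(\<lambda>n. cap2 \<phi> (s n)) \<longlonglongrightarrow> 0"
          using continuous_on_tendsto_compose[OF continuous_on_cap2[OF \<phi>(1)] s(3)] s'(2) by simp
        show "0 < cap2 \<phi> (s n)" for n using cap12[OF s(1,2)[of n]] by linarith
        show "(\<lambda>n. C (s n) / cap2 \<phi> (s n)) \<longlonglongrightarrow> \<tau>" using lim by (simp add: C_def)
      qed
    qed
    define e where "e = (\<lambda>n. 1 / real (Suc n))"
    have e: "0 < e n" for n by (simp add: e_def)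
    have e0: "e \<longlonglongrightarrow> 0" unfolding e_def by (rule LIMSEQ_Suc[OF lim_const_over_n])
    \<comment> \<open>The scales at which the curves nearly coincide pin down the constant.\<close>
    have "c * complex_of_real 1 = 1"
    proof -
      obtain s where s: "\<And>n. 0 < s n" "\<And>n. s n < e n" "\<And>n. s n \<le> 1/2" "\<And>n. cap2 \<phi> (s n) < (1 + e n) * cap1 \<phi> (s n)"
        using low[OF e] by metis
      have "s \<longlonglongrightarrow> 0" using s(1,2) by (intro tendsto_sandwich[OF _ _ tendsto_const e0]) (auto intro!: always_eventually less_imp_le)
      moreover have "(\<lambda>n. cap1 \<phi> (s n) / cap2 \<phi> (s n)) \<longlonglongrightarrow> 1"
      proof (rule tendsto_sandwich)
        have "(\<lambda>n. 1 / (1 + e n)) \<longlonglongrightarrow> 1 / (1 + 0)" using e0 by (intro tendsto_intros) auto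
        then show "(\<lambda>n. 1 / (1 + e n)) \<longlonglongrightarrow> 1" by simp
        have "1 / (1 + e n) \<le> cap1 \<phi> (s n) / cap2 \<phi> (s n) \<and> cap1 \<phi> (s n) / cap2 \<phi> (s n) \<le> 1" for n
          using cap12[OF s(1,3)[of n]] s(4)[of n] e[of n] by (auto simp: divide_simps mult.commute)
        then show "eventually (\<lambda>n. 1 / (1 + e n) \<le> cap1 \<phi> (s n) / cap2 \<phi> (s n)) sequentially"
          "eventually (\<lambda>n. cap1 \<phi> (s n) / cap2 \<phi> (s n) \<le> 1) sequentially" by auto
      qed auto
      ultimately show ?thesis using rate[of s 1] s(1,3) by blast
    qed
    then have "c = 1" by simp
    obtain s where s: "\<And>n. 0 < s n" "\<And>n. s n < e n" "\<And>n. s n \<le> 1/2" "\<And>n. 5/4 * cap1 \<phi> (s n) < cap2 \<phi> (s n)"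
      using high[OF e] by metis
    have s0: "s \<longlonglongrightarrow> 0" using s(1,2) by (intro tendsto_sandwich[OF _ _ tendsto_const e0]) (auto intro!: always_eventually less_imp_le)
    let ?q = "\<lambda>n. cap1 \<phi> (s n) / cap2 \<phi> (s n)"
    \<comment> \<open>Ratios above 5/4 invert to at most 4/5. They need not converge, so compactness
      supplies a limit \<open>\<tau>\<close> along a subsequence, which \<open>c = 1\<close> then
      forces to be 1.\<close>
    have q: "?q n \<in> {0..4/5}" for n
      using cap12[OF s(1,3)[of n]] s(4)[of n] by (auto simp: divide_simps)
    obtain \<tau> k where "\<tau> \<in> {0..4/5}" "strict_mono (k :: nat \<Rightarrow> nat)" "(?q \<circ> k) \<longlonglongrightarrow> \<tau>"
      using compact_Icc[of 0 "4/5 :: real", unfolded compact_def, rule_format, of ?q] q by blast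
    then have \<tau>: "\<tau> \<in> {0..4/5}" "strict_mono k" "(\<lambda>n. ?q (k n)) \<longlonglongrightarrow> \<tau>" by (simp_all add: comp_def)
    have "c * complex_of_real \<tau> = 1"
      using rate[of "\<lambda>n. s (k n)" \<tau>] s(1,3) \<tau>(3) LIMSEQ_subseq_LIMSEQ[OF s0 \<tau>(2)] by (simp add: comp_def)
    then have "\<tau> = 1" using \<open>c = 1\<close> by simp
    then show False using \<tau>(1) by simp
  qed
  moreover have "norm (\<gamma>1 0) = 1" "norm (\<gamma>2 0) = 1" "norm (1 :: complex) = 1" using \<gamma>0 by simp_all
  moreover have "inj_on \<gamma>1 {0..T}" "inj_on \<gamma>2 {0..T}" unfolding \<gamma>1_def \<gamma>2_def by (rule inj\<gamma>)+
  moreover have "\<gamma>1 ` {0..T} \<subseteq> cball 0 1 - {0}" "\<gamma>2 ` {0..T} \<subseteq> cball 0 1 - {0}"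
    unfolding \<gamma>1_def \<gamma>2_def by (rule sub\<gamma>)+
  moreover have "\<gamma>1 ` {0<..T} \<subseteq> ball 0 1 - {0}" "\<gamma>2 ` {0<..T} \<subseteq> ball 0 1 - {0}"
    unfolding \<gamma>1_def \<gamma>2_def by (rule sub\<gamma>')+
  ultimately show ?thesis
    using T cont disj clos lp1 lp2 by (intro exI[of _ T] conjI exI[of _ \<gamma>1] exI[of _ \<gamma>2] exI[of _ 1] ballI)
qed

end
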